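(* Let $A_1,\dots,A_n\in\mathbb{R}^d$, let $\phi_1,\dots,\phi_n:\mathbb{R}\to\mathbb{R}$ be convex and $1/\gamma$-smooth ($\gamma>0$), let $g:\mathbb{R}^d\to\mathbb{R}$ be convex with convexity parameter $1$ (i.e. $1$-strongly convex), with respect to the Euclidean norm, and let $\lambda>0$. Suppose $\|A_i\|_2\le R$ for all $i=1,\dots,n$. Let $D$ be the dual objective defined in the context, $D^\star=\max_{x\in\mathbb{R}^n}D(x)$, and $x^\star$ the (unique) maximizer of $D$. Let $\{x^{(k)}\}$ be generated by the APCG method described in the context (applied to minimize $-D$), started from $x^{(0)}\in\mathrm{dom}(\Psi)$, and put $$C=D^\star-D(x^{(0)})+\frac{\gamma}{2n}\|x^{(0)}-x^\star\|_2^2.$$ Then for every $\epsilon>0$, in order to obtain $\mathbf{E}[D^\star-D(x^{(k)})]\le\epsilon$ it suffices to have $$k\ \ge\ \left(n+\sqrt{\frac{nR^2}{\lambda\gamma}}\right)\log(C/\epsilon).$$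
   Context: A convex function $\phi:\mathbb{R}\to\mathbb{R}$ is $1/\gamma$-smooth if it is differentiable with $(1/\gamma)$-Lipschitz derivative. $\phi_i^*(u)=\sup_z\{zu-\phi_i(z)\}$ and $g^*$ are convex conjugates. Let $A=[A_1,\dots,A_n]\in\mathbb{R}^{d\times n}$. The regularized empirical risk minimization problem is $\min_{w\in\mathbb{R}^d}P(w)$, $P(w)=\frac1n\sum_{i=1}^n\phi_i(A_i^Tw)+\lambda g(w)$; its dual is $\max_{x\in\mathbb{R}^n}D(x)$ with $$D(x)=\frac1n\sum_{i=1}^n-\phi_i^*(-x_i)-\lambda g^*\Big(\frac{1}{\lambda n}Ax\Big)\in[-\infty,\infty).$$ APCG is applied to $F=-D=f+\Psi$ with $$f(x)=\lambda g^*\Big(\frac{1}{\lambda n}Ax\Big)+\frac{\gamma}{2n}\|x\|_2^2,\qquad \Psi(x)=\sum_{i=1}^n\Psi_i(x_i),\quad \Psi_i(x_i)=\frac1n\Big(\phi_i^*(-x_i)-\frac{\gamma}{2}x_i^2\Big),$$ with $n$ blocks, each a single coordinate, with coordinate Lipschitz constants $L_i=\frac{\|A_i\|_2^2}{\lambda n^2}+\frac{\gamma}{n}$, weighted norm $\|x\|_L=(\sum_iL_ix_i^2)^{1/2}$, and convexity parameter $\mu=\frac{\lambda\gamma n}{R^2+\lambda\gamma n}$. APCG method: set $\alpha=\sqrt{\mu}/n$, $z^{(0)}=x^{(0)}\in\mathrm{dom}(\Psi)$. For $k=0,1,2,\dots$: (1) $y^{(k)}=\frac{x^{(k)}+\alpha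 z^{(k)}}{1+\alpha}$; (2) choose $i_k\in\{1,\dots,n\}$ uniformly at random, independently of the past, and set $z^{(k+1)}=\arg\min_{x\in\mathbb{R}^n}\big\{\frac{n\alpha}{2}\|x-(1-\alpha)z^{(k)}-\alpha y^{(k)}\|_L^2+\nabla_{i_k}f(y^{(k)})\,(x_{i_k}-y^{(k)}_{i_k})+\Psi_{i_k}(x_{i_k})\big\}$, where $\nabla_if$ is the $i$th partial derivative; (3) $x^{(k+1)}=y^{(k)}+n\alpha(z^{(k+1)}-z^{(k)})+n\alpha^2(z^{(k)}-y^{(k)})$. The expectation is over $i_0,\dots,i_{k-1}$. *)

theory Defs
  imports "HOL-Probability.Probability"
begin

definition lipschitz_smooth :: "real \<Rightarrow> (real \<Rightarrow> real) \<Rightarrow> bool" where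
  "lipschitz_smooth \<beta> \<phi> \<longleftrightarrow>
     (\<forall>u. \<phi> field_differentiable at u) \<and> \<beta>-lipschitz_on UNIV (deriv \<phi>)"

definition strongly_convex :: "real \<Rightarrow> ('a::real_normed_vector \<Rightarrow> real) \<Rightarrow> bool" where
  "strongly_convex m g \<longleftrightarrow>
     (\<forall>v w. \<forall>t\<in>{0..1}. g ((1 - t) *\<^sub>R v + t *\<^sub>R w)
        \<le> (1 - t) * g v + t * g w - m / 2 * t * (1 - t) * (norm (v - w))\<^sup>2)"

(* On type real the inner product is multiplication, so this covers both the conjugates of the
   scalar losses and that of the regularizer. *)
definition conjugate :: "('a::real_inner \<Rightarrow> real) \<Rightarrow> 'a \<Rightarrow> ereal" where
  "conjugate f u = (SUP z. ereal (u \<bullet> z - f z))"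

definition partial_deriv :: "'n \<Rightarrow> (real ^ 'n \<Rightarrow> real) \<Rightarrow> real ^ 'n \<Rightarrow> real" where
  "partial_deriv i f v = deriv (\<lambda>t. f (v + t *\<^sub>R axis i 1)) 0"

definition weighted_norm :: "('n::finite \<Rightarrow> real) \<Rightarrow> real ^ 'n \<Rightarrow> real" where
  "weighted_norm L v = sqrt (\<Sum>i\<in>UNIV. L i * (v $ i)\<^sup>2)"

(* The data matrix has the vectors A_i as its columns; in the definitions below n is CARD('n). *)

definition dual_objective ::
  "('n::finite \<Rightarrow> real \<Rightarrow> real) \<Rightarrow> (real ^ 'd \<Rightarrow> real) \<Rightarrow> real ^ 'n ^ 'd::finite \<Rightarrow> real
     \<Rightarrow> real ^ 'n \<Rightarrow> ereal" where
  "dual_objective \<phi> g A lam x =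
     ereal (1 / real CARD('n)) * (\<Sum>i\<in>UNIV. - conjugate (\<phi> i) (- (x $ i)))
     - ereal lam * conjugate g ((1 / (lam * real CARD('n))) *\<^sub>R (A *v x))"

(* The conjugate of a real-valued strongly convex g is finite everywhere, so real_of_ereal
   discards nothing here. *)
definition smooth_part ::
  "(real ^ 'd \<Rightarrow> real) \<Rightarrow> real ^ 'n ^ 'd::finite \<Rightarrow> real \<Rightarrow> real \<Rightarrow> real ^ 'n::finite \<Rightarrow> real" where
  "smooth_part g A lam \<gamma> x =
     lam * real_of_ereal (conjugate g ((1 / (lam * real CARD('n))) *\<^sub>R (A *v x)))
     + \<gamma> / (2 * real CARD('n)) * (norm x)\<^sup>2"

definition separable_part ::
  "('n::finite \<Rightarrow> real \<Rightarrow> real) \<Rightarrow> real \<Rightarrow> 'n \<Rightarrow> real \<Rightarrow> ereal" where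
  "separable_part \<phi> \<gamma> i u =
     ereal (1 / real CARD('n)) * (conjugate (\<phi> i) (- u) - ereal (\<gamma> / 2 * u\<^sup>2))"

definition separable_dom :: "('n::finite \<Rightarrow> real \<Rightarrow> ereal) \<Rightarrow> (real ^ 'n) set" where
  "separable_dom \<Psi> = {x. (\<Sum>i\<in>UNIV. \<Psi> i (x $ i)) < \<infinity>}"

definition coord_lipschitz ::
  "real ^ 'n ^ 'd::finite \<Rightarrow> real \<Rightarrow> real \<Rightarrow> 'n::finite \<Rightarrow> real" where
  "coord_lipschitz A lam \<gamma> i =
     (norm (column i A))\<^sup>2 / (lam * (real CARD('n))\<^sup>2) + \<gamma> / real CARD('n)"

(* x, y, z are the iterates produced when coordinate idx k is selected in iteration k. *)
definition apcg_sequence ::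
  "(real ^ 'n \<Rightarrow> real) \<Rightarrow> ('n \<Rightarrow> real \<Rightarrow> ereal) \<Rightarrow> ('n \<Rightarrow> real) \<Rightarrow> real \<Rightarrow> real ^ 'n::finite
     \<Rightarrow> (nat \<Rightarrow> 'n) \<Rightarrow> (nat \<Rightarrow> real ^ 'n) \<Rightarrow> (nat \<Rightarrow> real ^ 'n) \<Rightarrow> (nat \<Rightarrow> real ^ 'n) \<Rightarrow> bool" where
  "apcg_sequence f \<Psi> L \<mu> x0 idx x y z \<longleftrightarrow>
     (let n = real CARD('n); \<alpha> = sqrt \<mu> / n in
        x 0 = x0 \<and> z 0 = x0 \<and>
        (\<forall>k.
          y k = (1 / (1 + \<alpha>)) *\<^sub>R (x k + \<alpha> *\<^sub>R z k) \<and>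
          is_arg_min
            (\<lambda>v. ereal (n * \<alpha> / 2 * (weighted_norm L (v - (1 - \<alpha>) *\<^sub>R z k - \<alpha> *\<^sub>R y k))\<^sup>2
                       + partial_deriv (idx k) f (y k) * (v $ idx k - y k $ idx k))
                 + \<Psi> (idx k) (v $ idx k))
            (\<lambda>v. True) (z (Suc k)) \<and>
          x (Suc k) = y k + (n * \<alpha>) *\<^sub>R (z (Suc k) - z k) + (n * \<alpha>\<^sup>2) *\<^sub>R (z k - y k)))"

definition iid_uniform :: "'w measure \<Rightarrow> (nat \<Rightarrow> 'w \<Rightarrow> 'n::finite) \<Rightarrow> bool" where
  "iid_uniform M I \<longleftrightarrow>
     prob_space.indep_vars M (\<lambda>_. count_space UNIV) I UNIV \<and>
     (\<forall>k. distr M (count_space UNIV) (I k) = uniform_count_measure UNIV)"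

end

theory Submission
  imports Defs
begin

text \<open>
  The conjugate of a \<open>1\<close>-strongly convex \<open>g\<close> is finite and \<open>1\<close>-smooth, and the conjugate of a
  \<open>1/\<gamma>\<close>-smooth \<open>\<phi>\<^sub>i\<close> is \<open>\<gamma>\<close>-strongly convex. Hence \<open>f\<close> is \<open>\<mu>\<close>-strongly convex for the norm weighted by its
  coordinate Lipschitz constants, and \<open>\<Psi>\<close> is convex. Put \<open>\<sigma> = sqrt \<mu>\<close> and \<open>\<alpha> = \<sigma>/n\<close>. The iterates
  satisfy \<open>x = \<sigma> z + (1 - \<sigma>) w\<close>, where \<open>w\<close> is a running convex average of the earlier \<open>z\<close>; with \<open>q\<close>
  the same average of the values \<open>\<Psi> z\<close>, Jensen's inequality gives \<open>\<Psi> x \<le> \<sigma> \<Psi> z + (1 - \<sigma>) q\<close>.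
  Averaged over the choice of the coordinate, one iteration multiplies the potential
  \<open>f x + \<sigma> \<Psi> z + (1 - \<sigma>) q - F\<^sup>* + \<mu>/2 \<parallel>z - x\<^sup>*\<parallel>\<^sub>L\<^sup>2\<close>, which dominates the dual gap, by at most \<open>1 - \<alpha>\<close>.
  It starts below \<open>C\<close>, and \<open>1/\<alpha> \<le> n + sqrt (n R\<^sup>2 / (\<lambda> \<gamma>))\<close>.
\<close>

subsection \<open>Conjugates of strongly convex and of smooth functions\<close>

lemma strongly_convex_imp_convex_on:
  fixes g :: "'a::real_normed_vector \<Rightarrow> real"
  assumes "strongly_convex m g" "m \<ge> 0"
  shows "convex_on UNIV g"
proof (rule convex_onI)
  fix t :: real and v w :: 'a
  assume t: "0 < t" "t < 1"
  have "g ((1 - t) *\<^sub>R v + t *\<^sub>R w)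
      \<le> (1 - t) * g v + t * g w - m / 2 * t * (1 - t) * (norm (v - w))\<^sup>2"
    using assms(1) t unfolding strongly_convex_def by auto
  moreover have "m / 2 * t * (1 - t) * (norm (v - w))\<^sup>2 \<ge> 0"
    using t assms(2) by simp
  ultimately show "g ((1 - t) *\<^sub>R v + t *\<^sub>R w) \<le> (1 - t) * g v + t * g w" by linarith
qed simp

lemma strongly_convex_diff_inner:
  fixes g :: "'a::real_inner \<Rightarrow> real"
  assumes "strongly_convex m g"
  shows "strongly_convex m (\<lambda>w. g w - u \<bullet> w)"
  unfolding strongly_convex_def
proof (intro allI ballI)
  fix v w :: 'a and t :: real
  assume "t \<in> {0..1}"
  then have "g ((1 - t) *\<^sub>R v + t *\<^sub>R w)
      \<le> (1 - t) * g v + t * g w - m / 2 * t * (1 - t) * (norm (v - w))\<^sup>2"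
    using assms unfolding strongly_convex_def by blast
  then show "g ((1 - t) *\<^sub>R v + t *\<^sub>R w) - u \<bullet> ((1 - t) *\<^sub>R v + t *\<^sub>R w)
      \<le> (1 - t) * (g v - u \<bullet> v) + t * (g w - u \<bullet> w) - m / 2 * t * (1 - t) * (norm (v - w))\<^sup>2"
    by (simp add: inner_add_right algebra_simps)
qed

text \<open>Far from 0, the segment from 0 to w meets the unit sphere at a point of value at least
  \<open>h c\<close>, and the quadratic gain along the segment then forces \<open>h w\<close> above
  \<open>h 0\<close>. A minimum over a large ball is therefore global.\<close>

lemma strongly_convex_attains_min:
  fixes h :: "'a::euclidean_space \<Rightarrow> real"
  assumes sc: "strongly_convex m h" and m: "m > 0"
  obtains z where "\<And>w. h z \<le> h w"
proof -
  have cont: "continuous_on S h" for S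
    using convex_on_continuous[OF open_UNIV strongly_convex_imp_convex_on[OF sc]] m
      continuous_on_subset by (metis less_imp_le subset_UNIV)
  obtain c where c: "\<And>w. norm w \<le> 1 \<Longrightarrow> h c \<le> h w"
    using continuous_attains_inf[of "cball 0 1 :: 'a set" h, OF compact_cball _ cont]
    by (metis cball_eq_empty dist_0_norm mem_cball not_one_less_zero)
  \<comment> \<open>The radius solves \<open>m / 2 * (r - 1) = h 0 - h c\<close>, the growth that
    the estimate along the segment requires.\<close>
  define r where "r = 1 + 2 * (h 0 - h c) / m"
  have hc: "h c \<le> h 0" using c[of 0] by simp
  then have r: "r \<ge> 1" using m by (simp add: r_def)
  have far: "h 0 \<le> h w" if w: "norm w \<ge> r" for w
  proof -
    define s where "s = norm w"
    define t where "t = 1 / s"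
    have s: "s \<ge> 1" using w r by (simp add: s_def)
    have t: "t \<in> {0..1}" "t * s = 1" using s by (auto simp: t_def)
    have "norm (t *\<^sub>R w) = 1" using t s_def by auto
    then have "h c \<le> h (t *\<^sub>R w)" using c by simp
    also have "\<dots> \<le> (1 - t) * h 0 + t * h w - m / 2 * t * (1 - t) * s\<^sup>2"
      using sc[unfolded strongly_convex_def, rule_format, OF t(1), of 0 w] by (simp add: s_def)
    also have "m / 2 * t * (1 - t) * s\<^sup>2 = m / 2 * (s - 1)"
      using s by (simp add: t_def power2_eq_square field_simps)
    finally have "t * (h w - h 0) \<ge> h c - h 0 + m / 2 * (s - 1)" by (simp add: algebra_simps)
    moreover have "m / 2 * (s - 1) \<ge> h 0 - h c"
    proof -
      have "m / 2 * (s - 1) \<ge> m / 2 * (r - 1)" using w m by (simp add: s_def)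
      then show ?thesis using m by (simp add: r_def)
    qed
    ultimately have "t * (h w - h 0) \<ge> 0" by linarith
    then show ?thesis using s by (simp add: t_def zero_le_divide_iff)
  qed
  obtain z where z: "\<And>w. norm w \<le> r \<Longrightarrow> h z \<le> h w"
    using continuous_attains_inf[of "cball 0 r :: 'a set" h, OF compact_cball _ cont] r
    by (metis cball_eq_empty dist_0_norm mem_cball not_le zero_le_one order_trans)
  have "h z \<le> h 0" using z[of 0] r by simp
  then have "h z \<le> h w" for w using z[of w] far[of w] by linarith
  then show ?thesis using that by blast
qed

text \<open>Comparing z with a point of the segment towards w and dividing by t leaves the quadratic
  gain with a factor 1 - t, which disappears as t tends to 0.\<close>

lemma strongly_convex_quadratic_growth:
  fixes h :: "'a::real_inner \<Rightarrow> real"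
  assumes sc: "strongly_convex m h" and min: "\<And>w. h z \<le> h w"
  shows "h z + m / 2 * (norm (w - z))\<^sup>2 \<le> h w"
proof -
  have "s * (m / 2 * (norm (w - z))\<^sup>2) \<le> h w - h z" if s: "0 < s" "s < 1" for s
  proof -
    define t where "t = 1 - s"
    have t: "t \<in> {0..1}" "t > 0" using s by (auto simp: t_def)
    have "h z \<le> h ((1 - t) *\<^sub>R z + t *\<^sub>R w)" by (rule min)
    also have "\<dots> \<le> (1 - t) * h z + t * h w - m / 2 * t * (1 - t) * (norm (z - w))\<^sup>2"
      using sc t unfolding strongly_convex_def by blast
    finally have "t * (s * (m / 2 * (norm (w - z))\<^sup>2)) \<le> t * (h w - h z)"
      by (simp add: t_def norm_minus_commute algebra_simps)
    then show ?thesis using t by simp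
  qed
  then have "m / 2 * (norm (w - z))\<^sup>2 \<le> h w - h z" by (rule field_le_mult_one_interval)
  then show ?thesis by simp
qed

lemma conjugate_ge: "ereal (u \<bullet> z - f z) \<le> conjugate f u"
  unfolding conjugate_def by (rule SUP_upper) simp

text \<open>\<open>\<zeta> u\<close> attains the supremum at u and acts as the gradient of G. Used
  as a competitor at u + v it gives the lower bound; the upper bound is quadratic growth around
  \<open>\<zeta> u\<close> combined with Young's inequality.\<close>

lemma conjugate_strongly_convex:
  fixes g :: "'a::euclidean_space \<Rightarrow> real"
  assumes sc: "strongly_convex m g" and m: "m > 0"
  obtains G \<zeta> where "\<And>u. conjugate g u = ereal (G u)"
    and "\<And>u v. G u + \<zeta> u \<bullet> v \<le> G (u + v)"
    and "\<And>u v. G (u + v) \<le> G u + \<zeta> u \<bullet> v + (norm v)\<^sup>2 / (2 * m)"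
proof -
  have "\<exists>z. \<forall>w. g z - u \<bullet> z \<le> g w - u \<bullet> w" for u
    using strongly_convex_attains_min[OF strongly_convex_diff_inner[OF sc] m] by metis
  then obtain \<zeta> where min: "\<And>u w. g (\<zeta> u) - u \<bullet> \<zeta> u \<le> g w - u \<bullet> w" by metis
  define G where "G u = u \<bullet> \<zeta> u - g (\<zeta> u)" for u
  have G: "conjugate g u = ereal (G u)" for u
    unfolding conjugate_def
  proof (rule SUP_eqI)
    show "ereal (u \<bullet> w - g w) \<le> ereal (G u)" for w
      using min[of u w] by (simp add: G_def)
  qed (auto simp: G_def)
  show ?thesis
  proof (rule that[of G \<zeta>])
    fix u v
    show "G u + \<zeta> u \<bullet> v \<le> G (u + v)"
      using min[of "u + v" "\<zeta> u"] by (simp add: G_def inner_add_left inner_commute[of "\<zeta> u"])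
    define w where "w = \<zeta> (u + v)"
    have "G (u + v) = u \<bullet> w - g w + v \<bullet> w" by (simp add: G_def w_def inner_add_left)
    also have "\<dots> \<le> G u - m / 2 * (norm (w - \<zeta> u))\<^sup>2 + v \<bullet> w"
      using strongly_convex_quadratic_growth[OF strongly_convex_diff_inner[OF sc] min, of u w]
      by (simp add: G_def)
    also have "\<dots> \<le> G u + \<zeta> u \<bullet> v + (norm v)\<^sup>2 / (2 * m)"
    proof -
      \<comment> \<open>Young's inequality, obtained from a completed square.\<close>
      have "0 \<le> (norm (v - m *\<^sub>R (w - \<zeta> u)))\<^sup>2 / (2 * m)" using m by simp
      also have "(norm (v - m *\<^sub>R (w - \<zeta> u)))\<^sup>2
          = (norm v)\<^sup>2 - 2 * m * (v \<bullet> (w - \<zeta> u)) + m\<^sup>2 * (norm (w - \<zeta> u))\<^sup>2"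
        by (simp only: power2_norm_eq_inner)
          (simp add: inner_diff_left inner_diff_right inner_commute power2_eq_square algebra_simps)
      also have "\<dots> / (2 * m)
          = (norm v)\<^sup>2 / (2 * m) - v \<bullet> (w - \<zeta> u) + m / 2 * (norm (w - \<zeta> u))\<^sup>2"
        using m by (simp add: field_simps power2_eq_square)
      finally show ?thesis by (simp add: inner_diff_right inner_commute)
    qed
    finally show "G (u + v) \<le> G u + \<zeta> u \<bullet> v + (norm v)\<^sup>2 / (2 * m)" .
  qed (rule G)
qed

text \<open>Subtracting the linear and quadratic terms from \<phi> leaves a function h whose
  derivative, by the Lipschitz bound, is nonnegative left of z and nonpositive right of z, so z
  maximizes h.\<close>

lemma lipschitz_smooth_upper:
  assumes "lipschitz_smooth \<beta> \<phi>"
  shows "\<phi> a \<le> \<phi> z + deriv \<phi> z * (a - z) + \<beta> / 2 * (a - z)\<^sup>2"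
proof -
  define h where "h a = \<phi> a - deriv \<phi> z * (a - z) - \<beta> / 2 * (a - z)\<^sup>2" for a
  have der: "(h has_real_derivative deriv \<phi> a - deriv \<phi> z - \<beta> * (a - z)) (at a)" for a
  proof -
    have "(\<phi> has_real_derivative deriv \<phi> a) (at a)"
      using assms field_differentiable_derivI unfolding lipschitz_smooth_def by blast
    then show ?thesis unfolding h_def by (auto intro!: derivative_eq_intros)
  qed
  have lip: "\<bar>deriv \<phi> a - deriv \<phi> z\<bar> \<le> \<beta> * \<bar>a - z\<bar>" for a
    using assms lipschitz_onD[of \<beta> UNIV "deriv \<phi>" a z]
    unfolding lipschitz_smooth_def dist_real_def by auto
  have "h a \<le> h z"
  proof (cases "z \<le> a")
    case True
    show ?thesis
    proof (rule DERIV_nonpos_imp_nonincreasing[OF True])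
      fix b assume "z \<le> b" "b \<le> a"
      then show "\<exists>D. (h has_real_derivative D) (at b) \<and> D \<le> 0"
        using der[of b] lip[of b] by (intro exI[of _ "deriv \<phi> b - deriv \<phi> z - \<beta> * (b - z)"]) auto
    qed
  next
    case False
    then have "a \<le> z" by simp
    then show ?thesis
    proof (rule DERIV_nonneg_imp_nondecreasing)
      fix b assume "a \<le> b" "b \<le> z"
      then show "\<exists>D. (h has_real_derivative D) (at b) \<and> 0 \<le> D"
        using der[of b] lip[of b] by (intro exI[of _ "deriv \<phi> b - deriv \<phi> z - \<beta> * (b - z)"])
          (auto simp: algebra_simps)
    qed
  qed
  then show ?thesis by (simp add: h_def)
qed

text \<open>Moving the test point \<open>z\<close> to \<open>z + t \<gamma> (u - v)\<close> for \<open>u\<close> and to \<open>z - (1 - t) \<gamma> (u - v)\<close>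
  for \<open>v\<close> makes the first-order terms of \<open>\<phi>\<close> cancel.\<close>

lemma conjugate_lipschitz_smooth:
  fixes \<phi> :: "real \<Rightarrow> real"
  assumes sm: "lipschitz_smooth (1 / \<gamma>) \<phi>" and \<gamma>: "\<gamma> > 0"
    and u: "conjugate \<phi> u \<le> ereal a" and v: "conjugate \<phi> v \<le> ereal b" and t: "0 \<le> t" "t \<le> 1"
  shows "conjugate \<phi> ((1 - t) * u + t * v)
    \<le> ereal ((1 - t) * a + t * b - \<gamma> / 2 * t * (1 - t) * (u - v)\<^sup>2)"
  unfolding conjugate_def
proof (rule SUP_least)
  fix z :: real
  define p where "p = z + t * \<gamma> * (u - v)"
  define q where "q = z - (1 - t) * \<gamma> * (u - v)"
  define d where "d = deriv \<phi> z"
  have "u * p - \<phi> p \<le> a"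
    using order_trans[OF conjugate_ge u, of p] by simp
  moreover have "\<phi> p \<le> \<phi> z + d * (t * \<gamma> * (u - v)) + \<gamma> / 2 * (t * (u - v))\<^sup>2"
    using lipschitz_smooth_upper[OF sm, of p z] \<gamma>
    by (simp add: p_def d_def power2_eq_square mult_ac)
  ultimately have p: "u * p - (\<phi> z + d * (t * \<gamma> * (u - v)) + \<gamma> / 2 * (t * (u - v))\<^sup>2) \<le> a"
    by linarith
  have "v * q - \<phi> q \<le> b"
    using order_trans[OF conjugate_ge v, of q] by simp
  moreover have "\<phi> q \<le> \<phi> z - d * ((1 - t) * \<gamma> * (u - v)) + \<gamma> / 2 * ((1 - t) * (u - v))\<^sup>2"
    using lipschitz_smooth_upper[OF sm, of q z] \<gamma>
    by (simp add: q_def d_def power2_eq_square mult_ac)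
  ultimately have q: "v * q - (\<phi> z - d * ((1 - t) * \<gamma> * (u - v)) + \<gamma> / 2 * ((1 - t) * (u - v))\<^sup>2) \<le> b"
    by linarith
  have "((1 - t) * u + t * v) * z - \<phi> z + \<gamma> / 2 * t * (1 - t) * (u - v)\<^sup>2
    = (1 - t) * (u * p - (\<phi> z + d * (t * \<gamma> * (u - v)) + \<gamma> / 2 * (t * (u - v))\<^sup>2))
      + t * (v * q - (\<phi> z - d * ((1 - t) * \<gamma> * (u - v)) + \<gamma> / 2 * ((1 - t) * (u - v))\<^sup>2))"
    unfolding p_def q_def power2_eq_square by (simp add: field_simps)
  also have "\<dots> \<le> (1 - t) * a + t * b"
    using mult_left_mono[OF p, of "1 - t"] mult_left_mono[OF q, of t] t by linarith
  finally show "ereal (((1 - t) * u + t * v) \<bullet> z - \<phi> z)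
      \<le> ereal ((1 - t) * a + t * b - \<gamma> / 2 * t * (1 - t) * (u - v)\<^sup>2)" by simp
qed

section \<open>Gradient and coordinate constants of the smooth part of the dual\<close>

lemma has_real_derivative_quadratic_sandwich:
  fixes f :: "real \<Rightarrow> real"
  assumes "\<And>t. \<bar>f t - f 0 - t * d\<bar> \<le> K * t\<^sup>2"
  shows "(f has_real_derivative d) (at 0)"
proof -
  have "((\<lambda>t. (f t - f 0) / t - d) \<longlongrightarrow> 0) (at 0)"
  proof (rule Lim_null_comparison)
    show "\<forall>\<^sub>F t in at 0. norm ((f t - f 0) / t - d) \<le> K * \<bar>t\<bar>"
    proof (rule eventually_at_filter[THEN iffD2], rule always_eventually, intro allI impI)
      fix t :: real assume t: "t \<noteq> 0"
      have "norm ((f t - f 0) / t - d) = \<bar>f t - f 0 - t * d\<bar> / \<bar>t\<bar>"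
        using t by (simp add: field_simps flip: abs_divide)
      also have "\<dots> \<le> K * t\<^sup>2 / \<bar>t\<bar>" using assms by (intro divide_right_mono) auto
      also have "t\<^sup>2 = \<bar>t\<bar> * \<bar>t\<bar>" by (simp add: power2_eq_square)
      also have "K * (\<bar>t\<bar> * \<bar>t\<bar>) / \<bar>t\<bar> = K * \<bar>t\<bar>"
        using nonzero_mult_div_cancel_right[of "\<bar>t\<bar>" "K * \<bar>t\<bar>"] t
        by (simp only: mult.assoc abs_eq_0 simp_thms)
      finally show "norm ((f t - f 0) / t - d) \<le> K * \<bar>t\<bar>" .
    qed
    have "((\<lambda>t. K * \<bar>t\<bar>) \<longlongrightarrow> K * \<bar>0\<bar>) (at (0::real))" by (intro tendsto_intros)
    then show "((\<lambda>t. K * \<bar>t\<bar>) \<longlongrightarrow> 0) (at (0::real))" by simp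
  qed
  from LIM_zero_cancel[OF this] show ?thesis by (simp add: has_field_derivative_iff)
qed

text \<open>The squared norm expands exactly, and its second-order term is the strong convexity; the
  conjugate contributes its linear lower bound. Along axis i the matrix maps a step t to t times
  column i, so 1-smoothness of the conjugate yields the coordinate constant.\<close>

lemma smooth_part_gradient:
  fixes A :: "real ^ 'n::finite ^ 'd::finite"
  assumes g: "strongly_convex 1 g" and lam: "lam > 0" and \<gamma>: "\<gamma> > 0"
  defines "f \<equiv> smooth_part g A lam \<gamma>"
  obtains grad where "\<And>i v. partial_deriv i f v = grad v $ i"
    and "\<And>v u. f v + grad v \<bullet> u + \<gamma> / (2 * real CARD('n)) * (norm u)\<^sup>2 \<le> f (v + u)"
    and "\<And>v i t. f (v + t *\<^sub>R axis i 1)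
      \<le> f v + t * grad v $ i + coord_lipschitz A lam \<gamma> i / 2 * t\<^sup>2"
proof -
  obtain G \<zeta> where G: "\<And>u. conjugate g u = ereal (G u)"
    and G_lower: "\<And>u v. G u + \<zeta> u \<bullet> v \<le> G (u + v)"
    and G_upper: "\<And>u v. G (u + v) \<le> G u + \<zeta> u \<bullet> v + (norm v)\<^sup>2 / (2 * 1)"
    using conjugate_strongly_convex[OF g] by auto
  define n where "n = real CARD('n)"
  have n: "n > 0" by (simp add: n_def)
  define c where "c = 1 / (lam * n)"
  have f: "f v = lam * G (c *\<^sub>R (A *v v)) + \<gamma> / (2 * n) * (norm v)\<^sup>2" for v
    by (simp add: f_def smooth_part_def G c_def n_def)
  \<comment> \<open>Chain rule: \<open>v* A\<close> applies the transpose of A, and the last term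
    differentiates the squared norm.\<close>
  define grad where "grad v = (lam * c) *\<^sub>R (\<zeta> (c *\<^sub>R (A *v v)) v* A) + (\<gamma> / n) *\<^sub>R v" for v
  have inner: "grad v \<bullet> u = lam * (\<zeta> (c *\<^sub>R (A *v v)) \<bullet> (c *\<^sub>R (A *v u))) + \<gamma> / n * (v \<bullet> u)" for v u
    by (simp add: grad_def inner_add_left dot_lmul_matrix)
  have norm_sq: "\<gamma> / (2 * n) * (norm (v + u))\<^sup>2
    = \<gamma> / (2 * n) * (norm v)\<^sup>2 + \<gamma> / n * (v \<bullet> u) + \<gamma> / (2 * n) * (norm u)\<^sup>2" for v u :: "real ^ 'n"
    using n by (simp add: power2_norm_eq_inner inner_add_left inner_add_right inner_commute field_simps)
  have arg: "c *\<^sub>R (A *v (v + u)) = c *\<^sub>R (A *v v) + c *\<^sub>R (A *v u)" for v u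
    by (simp add: matrix_vector_right_distrib scaleR_add_right)
  have lower: "f v + grad v \<bullet> u + \<gamma> / (2 * n) * (norm u)\<^sup>2 \<le> f (v + u)" for v u
    using mult_left_mono[OF G_lower[of "c *\<^sub>R (A *v v)" "c *\<^sub>R (A *v u)"], of lam] lam
    unfolding f arg norm_sq inner by (simp add: algebra_simps)
  have upper: "f (v + u) \<le> f v + grad v \<bullet> u + lam * ((norm (c *\<^sub>R (A *v u)))\<^sup>2 / 2)
      + \<gamma> / (2 * n) * (norm u)\<^sup>2" for v u
    using mult_left_mono[OF G_upper[of "c *\<^sub>R (A *v v)" "c *\<^sub>R (A *v u)"], of lam] lam
    unfolding f arg norm_sq inner by (simp add: algebra_simps)
  have coord: "f (v + t *\<^sub>R axis i 1) \<le> f v + t * grad v $ i + coord_lipschitz A lam \<gamma> i / 2 * t\<^sup>2"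
    for v i t
  proof -
    have e1: "grad v \<bullet> (t *\<^sub>R axis i 1) = t * grad v $ i" by (simp add: inner_axis)
    have e2: "(norm (c *\<^sub>R (A *v (t *\<^sub>R axis i 1))))\<^sup>2 = c\<^sup>2 * t\<^sup>2 * (norm (column i A))\<^sup>2"
      by (simp add: matrix_vector_mult_scaleR matrix_vector_mult_basis power_mult_distrib)
    have e3: "(norm (t *\<^sub>R axis i 1 :: real ^ 'n))\<^sup>2 = t\<^sup>2"
      by simp
    have e4: "lam * (c\<^sup>2 * t\<^sup>2 * (norm (column i A))\<^sup>2 / 2) + \<gamma> / (2 * n) * t\<^sup>2
        = coord_lipschitz A lam \<gamma> i / 2 * t\<^sup>2"
      using lam n unfolding coord_lipschitz_def c_def n_def[symmetric]
      by (simp add: field_simps power2_eq_square)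
    show ?thesis using upper[of v "t *\<^sub>R axis i 1"] e4 unfolding e1 e2 e3 by linarith
  qed
  \<comment> \<open>Along the axis f lies between its linearization and the quadratic upper bound,
    which determines the derivative at 0.\<close>
  have "partial_deriv i f v = grad v $ i" for i v
    unfolding partial_deriv_def
  proof (rule DERIV_imp_deriv, rule has_real_derivative_quadratic_sandwich)
    fix t :: real
    have L: "coord_lipschitz A lam \<gamma> i \<ge> 0" using lam \<gamma> by (simp add: coord_lipschitz_def)
    have "f v + t * grad v $ i \<le> f (v + t *\<^sub>R axis i 1)"
    proof -
      have "0 \<le> \<gamma> / (2 * n) * (norm (t *\<^sub>R axis i 1 :: real ^ 'n))\<^sup>2" using \<gamma> n by simp
      then show ?thesis using lower[of v "t *\<^sub>R axis i 1"] by (simp add: inner_axis)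
    qed
    moreover have "0 \<le> coord_lipschitz A lam \<gamma> i / 2 * t\<^sup>2" using L by simp
    ultimately show "\<bar>f (v + t *\<^sub>R axis i 1) - f (v + 0 *\<^sub>R axis i 1) - t * grad v $ i\<bar>
        \<le> coord_lipschitz A lam \<gamma> i / 2 * t\<^sup>2"
      using coord[of v t i] by simp
  qed
  then show ?thesis using that lower coord unfolding n_def by blast
qed

subsection \<open>Accelerated coordinate descent\<close>

text \<open>The interpolation argument of \<open>strongly_convex_quadratic_growth\<close>,
  restricted to the effective domain S of p. The gain comes from the quadratic with coefficient c,
  while p is merely convex.\<close>

lemma convex_on_prox_growth:
  fixes p :: "real \<Rightarrow> real"
  assumes p: "convex_on S p" and z: "z \<in> S" and v: "v \<in> S"
    and min: "\<And>v. v \<in> S \<Longrightarrow> p z + d * z + c / 2 * (z - s)\<^sup>2 \<le> p v + d * v + c / 2 * (v - s)\<^sup>2"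
  shows "p z + d * z + c / 2 * (z - s)\<^sup>2 + c / 2 * (v - z)\<^sup>2 \<le> p v + d * v + c / 2 * (v - s)\<^sup>2"
proof -
  have "r * (c / 2 * (v - z)\<^sup>2)
      \<le> p v + d * v + c / 2 * (v - s)\<^sup>2 - (p z + d * z + c / 2 * (z - s)\<^sup>2)"
    if r: "0 < r" "r < 1" for r
  proof -
    define t where "t = 1 - r"
    have t: "0 < t" "t < 1" using r by (auto simp: t_def)
    define u where "u = (1 - t) * z + t * v"
    have u: "u \<in> S" and pu: "p u \<le> (1 - t) * p z + t * p v"
      using convex_onD[OF p, of t z v] convex_on_imp_convex[OF p] t z v
        convexD_alt[of S z v t] by (auto simp: u_def)
    have "p z + d * z + c / 2 * (z - s)\<^sup>2 \<le> p u + d * u + c / 2 * (u - s)\<^sup>2" by (rule min[OF u])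
    also have "\<dots> \<le> (1 - t) * p z + t * p v + d * u + c / 2 * (u - s)\<^sup>2" using pu by simp
    finally have "t * (r * (c / 2 * (v - z)\<^sup>2))
        \<le> t * (p v + d * v + c / 2 * (v - s)\<^sup>2 - (p z + d * z + c / 2 * (z - s)\<^sup>2))"
      by (simp add: u_def t_def power2_eq_square algebra_simps add_divide_distrib diff_divide_distrib)
    then show ?thesis using t by simp
  qed
  then have "c / 2 * (v - z)\<^sup>2
      \<le> p v + d * v + c / 2 * (v - s)\<^sup>2 - (p z + d * z + c / 2 * (z - s)\<^sup>2)"
    by (rule field_le_mult_one_interval)
  then show ?thesis by simp
qed

text \<open>The term \<open>s k\<close> enters only at \<open>Suc k\<close>. With s the iterates z,
  the average for step k + 1 is thus fixed before index k is drawn and is the same for every choice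
  of the coordinate.\<close>

primrec averaged :: "real \<Rightarrow> (nat \<Rightarrow> 'a::real_vector) \<Rightarrow> nat \<Rightarrow> 'a" where
  "averaged b s 0 = s 0"
| "averaged b s (Suc k) = (1 - b) *\<^sub>R averaged b s k + b *\<^sub>R s k"

lemma averaged_cong: "(\<And>j. j \<le> k \<Longrightarrow> s j = s' j) \<Longrightarrow> averaged b s k = averaged b s' k"
  by (induction k) auto

text \<open>The first identity puts the prox centre on the segment from x to z, hence into a convex
  domain. The second puts y between x and that centre, which later splits the gradient term.\<close>

lemma extrapolation_combination:
  fixes x z :: "'a::real_vector" and a :: real
  assumes a: "a > 0" and y: "y = (1 / (1 + a)) *\<^sub>R (x + a *\<^sub>R z)"
  shows "(1 - a) *\<^sub>R z + a *\<^sub>R y = (1 - 1 / (1 + a)) *\<^sub>R x + (1 / (1 + a)) *\<^sub>R z"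
    and "y = (1 - a) *\<^sub>R x + a *\<^sub>R ((1 - a) *\<^sub>R z + a *\<^sub>R y)"
proof -
  have "(1 - a) *\<^sub>R z + a *\<^sub>R y = (a / (1 + a)) *\<^sub>R x + (1 - a + a * a / (1 + a)) *\<^sub>R z"
    by (simp add: y scaleR_add_right scaleR_add_left)
  also have "a / (1 + a) = 1 - 1 / (1 + a)"
    using a by (simp add: field_simps)
  also have "1 - a + a * a / (1 + a) = 1 / (1 + a)"
    using a by (simp add: field_simps)
  finally show comb: "(1 - a) *\<^sub>R z + a *\<^sub>R y
      = (1 - 1 / (1 + a)) *\<^sub>R x + (1 / (1 + a)) *\<^sub>R z" .
  have "(1 - a) *\<^sub>R x + a *\<^sub>R ((1 - a) *\<^sub>R z + a *\<^sub>R y)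
      = (1 - a + a * (1 - 1 / (1 + a))) *\<^sub>R x + (a / (1 + a)) *\<^sub>R z"
    unfolding comb by (simp add: scaleR_add_right scaleR_add_left)
  also have "1 - a + a * (1 - 1 / (1 + a)) = 1 / (1 + a)"
    using a by (simp add: field_simps)
  finally show "y = (1 - a) *\<^sub>R x + a *\<^sub>R ((1 - a) *\<^sub>R z + a *\<^sub>R y)"
    by (simp add: y scaleR_add_right)
qed

text \<open>The extended-valued separable terms are modelled by real functions \<open>p i\<close> on
  their effective domains \<open>S i\<close>. The vector field \<open>grad\<close> enters only
  through the two quadratic bounds.\<close>

locale coordinate_descent =
  fixes f :: "real ^ 'n::finite \<Rightarrow> real" and grad :: "real ^ 'n \<Rightarrow> real ^ 'n"
    and S :: "'n \<Rightarrow> real set" and p :: "'n \<Rightarrow> real \<Rightarrow> real"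
    and L :: "'n \<Rightarrow> real" and \<mu> :: real
  assumes p_convex: "\<And>i. convex_on (S i) (p i)"
    and L_pos: "\<And>i. L i > 0"
    and mu: "0 < \<mu>" "\<mu> \<le> 1"
    and f_strong: "\<And>v u. f v + grad v \<bullet> u + \<mu> / 2 * (weighted_norm L u)\<^sup>2 \<le> f (v + u)"
    and f_coord: "\<And>v i t. f (v + t *\<^sub>R axis i 1) \<le> f v + t * grad v $ i + L i / 2 * t\<^sup>2"
begin

definition Dom :: "(real ^ 'n) set" where "Dom = {v. \<forall>i. v $ i \<in> S i}"
definition Psi :: "real ^ 'n \<Rightarrow> real" where "Psi v = (\<Sum>i\<in>UNIV. p i (v $ i))"
definition \<alpha> :: real where "\<alpha> = sqrt \<mu> / real CARD('n)"
text \<open>This rate preserves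
  \<open>x = sqrt \<mu> *\<^sub>R z + (1 - sqrt \<mu>) *\<^sub>R w\<close> when w moves to
  \<open>(1 - b) *\<^sub>R w + b *\<^sub>R z\<close>: the coefficients of w require
  \<open>1 - b = (1 - sqrt \<mu> * \<alpha>) / (1 + \<alpha>)\<close>.\<close>

definition b :: real where "b = \<alpha> * (1 + sqrt \<mu>) / (1 + \<alpha>)"

lemma sqrt_mu: "0 < sqrt \<mu>" "sqrt \<mu> \<le> 1" "real CARD('n) * \<alpha> = sqrt \<mu>" "sqrt \<mu> * sqrt \<mu> = \<mu>"
  using mu by (auto simp: \<alpha>_def)

lemma \<alpha>_bounds: "0 < \<alpha>" "\<alpha> \<le> 1"
proof -
  show "0 < \<alpha>" using mu by (simp add: \<alpha>_def)
  have "real CARD('n) \<ge> 1" by (simp add: Suc_leI)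
  then show "\<alpha> \<le> 1" using order_trans[OF sqrt_mu(2)] by (simp add: \<alpha>_def)
qed

lemma b_bounds: "0 \<le> b" "b \<le> 1"
proof -
  show "0 \<le> b" using sqrt_mu \<alpha>_bounds by (simp add: b_def)
  have "\<alpha> * sqrt \<mu> \<le> 1" using sqrt_mu \<alpha>_bounds by (simp add: mult_le_one)
  then show "b \<le> 1" using \<alpha>_bounds by (simp add: b_def algebra_simps)
qed

lemma weighted_norm_sq: "(weighted_norm L v)\<^sup>2 = (\<Sum>i\<in>UNIV. L i * (v $ i)\<^sup>2)"
  unfolding weighted_norm_def
  by (rule real_sqrt_pow2) (auto intro!: sum_nonneg simp: L_pos less_imp_le)

lemma Dom_convex: "v \<in> Dom \<Longrightarrow> w \<in> Dom \<Longrightarrow> 0 \<le> t \<Longrightarrow> t \<le> 1 \<Longrightarrow> (1 - t) *\<^sub>R v + t *\<^sub>R w \<in> Dom"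
  using p_convex[THEN convex_on_imp_convex] convexD_alt
  by (fastforce simp: Dom_def)

lemma Psi_convex:
  assumes "v \<in> Dom" "w \<in> Dom" "0 \<le> t" "t \<le> 1"
  shows "Psi ((1 - t) *\<^sub>R v + t *\<^sub>R w) \<le> (1 - t) * Psi v + t * Psi w"
proof -
  have "p i ((1 - t) * v $ i + t * w $ i) \<le> (1 - t) * p i (v $ i) + t * p i (w $ i)" for i
    using convex_onD[OF p_convex, of t "v $ i" i "w $ i"] assms by (simp add: Dom_def)
  then show ?thesis
    by (simp add: Psi_def sum_distrib_left sum_mono flip: sum.distrib)
qed

lemma weighted_norm_sq_convex:
  assumes "0 \<le> t" "t \<le> 1"
  shows "(weighted_norm L ((1 - t) *\<^sub>R v + t *\<^sub>R w))\<^sup>2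
    \<le> (1 - t) * (weighted_norm L v)\<^sup>2 + t * (weighted_norm L w)\<^sup>2"
proof -
  have "L i * ((1 - t) * v $ i + t * w $ i)\<^sup>2
      \<le> (1 - t) * (L i * (v $ i)\<^sup>2) + t * (L i * (w $ i)\<^sup>2)" for i
  proof -
    have "0 \<le> L i * (t * (1 - t) * (v $ i - w $ i)\<^sup>2)"
      using assms L_pos[of i] by simp
    then show ?thesis by (simp add: power2_eq_square algebra_simps)
  qed
  then show ?thesis
    by (simp add: weighted_norm_sq sum_distrib_left sum_mono flip: sum.distrib)
qed

text \<open>The optimality condition of the coordinate subproblem at \<open>z'\<close>, with the quadratic growth
  that strong convexity adds to it.\<close>

definition prox_step :: "'n \<Rightarrow> real ^ 'n \<Rightarrow> real ^ 'n \<Rightarrow> real ^ 'n \<Rightarrow> bool" where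
  "prox_step i y s z' \<longleftrightarrow> (\<forall>j. j \<noteq> i \<longrightarrow> z' $ j = s $ j) \<and> z' $ i \<in> S i \<and>
    (\<forall>v\<in>S i. p i (z' $ i) + grad y $ i * z' $ i + sqrt \<mu> * L i / 2 * (z' $ i - s $ i)\<^sup>2
        + sqrt \<mu> * L i / 2 * (v - z' $ i)\<^sup>2
      \<le> p i v + grad y $ i * v + sqrt \<mu> * L i / 2 * (v - s $ i)\<^sup>2)"

text \<open>Each growth inequality is tested at the other solution; their sum bounds a positive
  multiple of the squared difference by 0. This makes the iterates functions of the index
  history.\<close>

lemma prox_step_unique:
  assumes u: "prox_step i y s u" and w: "prox_step i y s w"
  shows "u = w"
proof -
  have "sqrt \<mu> * L i / 2 * (w $ i - u $ i)\<^sup>2 + sqrt \<mu> * L i / 2 * (u $ i - w $ i)\<^sup>2 \<le> 0"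
    using u w unfolding prox_step_def by fastforce
  then have "sqrt \<mu> * L i * (u $ i - w $ i)\<^sup>2 \<le> 0"
    by (simp add: power2_commute[of "w $ i"] mult_ac)
  moreover have "sqrt \<mu> * L i > 0" using sqrt_mu L_pos by simp
  ultimately have "(u $ i - w $ i)\<^sup>2 \<le> 0" by (metis mult_le_cancel_left_pos mult_zero_right)
  then have "u $ i = w $ i" by simp
  then show ?thesis using u w unfolding prox_step_def vec_eq_iff by metis
qed

text \<open>The sum over the selected index is n times a conditional expectation. Since
  \<open>Z i\<close> differs from s at most in coordinate i, each old value
  \<open>q j (s $ j)\<close> survives in the n - 1 summands with i different from j.\<close>

lemma prox_step_sum:
  fixes s :: "real ^ 'n" and q :: "'n \<Rightarrow> real \<Rightarrow> real"
  assumes "\<And>i. prox_step i y s (Z i)"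
  shows "(\<Sum>i\<in>UNIV. \<Sum>j\<in>UNIV. q j (Z i $ j))
    = (real CARD('n) - 1) * (\<Sum>j\<in>UNIV. q j (s $ j)) + (\<Sum>i\<in>UNIV. q i (Z i $ i))"
proof -
  have "(\<Sum>j\<in>UNIV. q j (Z i $ j)) = (\<Sum>j\<in>UNIV. q j (s $ j)) + (q i (Z i $ i) - q i (s $ i))" for i
  proof -
    have "(\<Sum>j\<in>UNIV - {i}. q j (Z i $ j)) = (\<Sum>j\<in>UNIV - {i}. q j (s $ j))"
      using assms by (intro sum.cong) (auto simp: prox_step_def)
    then show ?thesis
      using sum.remove[of UNIV i "\<lambda>j. q j (Z i $ j)"] sum.remove[of UNIV i "\<lambda>j. q j (s $ j)"]
      by simp
  qed
  then show ?thesis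
    by (simp only: sum.distrib sum_subtractf) (simp add: algebra_simps)
qed

text \<open>The new \<open>x\<close> is not a convex combination of the old \<open>x\<close> and the old and new \<open>z\<close>, so
  \<open>Psi x\<close> cannot be bounded from one step to the next. It is replaced by the upper bound
  \<open>sqrt \<mu> * Psi z + (1 - sqrt \<mu>) * q\<close>, with \<open>q\<close> an average of \<open>Psi\<close> over the past \<open>z\<close>.\<close>

definition potential :: "real ^ 'n \<Rightarrow> real ^ 'n \<Rightarrow> real ^ 'n \<Rightarrow> real \<Rightarrow> real" where
  "potential xs x z q = f x + sqrt \<mu> * Psi z + (1 - sqrt \<mu>) * q
     + \<mu> / 2 * (weighted_norm L (z - xs))\<^sup>2 - (f xs + Psi xs)"

text \<open>Coordinate smoothness bounds \<open>f (X i)\<close>; the prox inequality absorbs the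
  first- and second-order terms of the displacement; strong convexity at y, towards xs and towards
  x, turns the remaining gradient terms into values of f.\<close>

lemma potential_descent:
  fixes Z X :: "'n \<Rightarrow> real ^ 'n"
  assumes xs: "xs \<in> Dom" and z: "z \<in> Dom" and w: "w \<in> Dom" and q: "Psi w \<le> q"
    and x: "x = sqrt \<mu> *\<^sub>R z + (1 - sqrt \<mu>) *\<^sub>R w"
    and y: "y = (1 / (1 + \<alpha>)) *\<^sub>R (x + \<alpha> *\<^sub>R z)"
    and Z: "\<And>i. prox_step i y ((1 - \<alpha>) *\<^sub>R z + \<alpha> *\<^sub>R y) (Z i)"
    and X: "\<And>i. X i = y + sqrt \<mu> *\<^sub>R (Z i - z) + (sqrt \<mu> * \<alpha>) *\<^sub>R (z - y)"
  shows "(\<Sum>i\<in>UNIV. potential xs (X i) (Z i) ((1 - b) * q + b * Psi z))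
    \<le> real CARD('n) * (1 - \<alpha>) * potential xs x z q"
proof -
  define N where "N = real CARD('n)"
  define \<sigma> where "\<sigma> = sqrt \<mu>"
  have N: "N \<ge> 1" by (simp add: N_def Suc_leI)
  have \<sigma>: "\<sigma> > 0" "\<sigma> \<le> 1" "\<sigma> = N * \<alpha>" "\<mu> = \<sigma> * \<sigma>"
    using sqrt_mu by (simp_all add: \<sigma>_def N_def)
  note \<alpha> = \<alpha>_bounds
  define s where "s = (1 - \<alpha>) *\<^sub>R z + \<alpha> *\<^sub>R y"
  note Zs = Z[folded s_def]
  define h where "h i = Z i $ i - s $ i" for i
  have x_Dom: "x \<in> Dom" and Psi_x: "Psi x \<le> \<sigma> * Psi z + (1 - \<sigma>) * q"
  proof -
    have eq: "x = (1 - \<sigma>) *\<^sub>R w + \<sigma> *\<^sub>R z" by (simp add: x \<sigma>_def)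
    show "x \<in> Dom" unfolding eq by (rule Dom_convex) (use \<sigma>(1,2) z w in auto)
    have "Psi x \<le> (1 - \<sigma>) * Psi w + \<sigma> * Psi z"
      unfolding eq by (rule Psi_convex) (use \<sigma>(1,2) z w in auto)
    also have "\<dots> \<le> (1 - \<sigma>) * q + \<sigma> * Psi z" using q \<sigma>(1,2) by (simp add: mult_left_mono)
    finally show "Psi x \<le> \<sigma> * Psi z + (1 - \<sigma>) * q" by simp
  qed
  have s_alt: "s = (1 - 1 / (1 + \<alpha>)) *\<^sub>R x + (1 / (1 + \<alpha>)) *\<^sub>R z"
    and y_alt: "y = (1 - \<alpha>) *\<^sub>R x + \<alpha> *\<^sub>R s"
    unfolding s_def by (rule extrapolation_combination[OF \<alpha>(1) y])+
  have Psi_s: "(1 + \<alpha>) * Psi s \<le> \<alpha> * (\<sigma> * Psi z + (1 - \<sigma>) * q) + Psi z"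
  proof -
    have "Psi s \<le> (1 - 1 / (1 + \<alpha>)) * Psi x + 1 / (1 + \<alpha>) * Psi z"
      unfolding s_alt by (rule Psi_convex) (use \<alpha> z x_Dom in auto)
    also have "\<dots> = (\<alpha> * Psi x + Psi z) / (1 + \<alpha>)"
      using \<alpha> by (simp add: diff_divide_eq_iff add_divide_distrib)
    finally have "(1 + \<alpha>) * Psi s \<le> \<alpha> * Psi x + Psi z"
      using \<alpha> by (simp add: pos_le_divide_eq mult.commute)
    then show ?thesis using mult_left_mono[OF Psi_x, of \<alpha>] \<alpha> by linarith
  qed
  \<comment> \<open>The update equals \<open>y + \<sigma> *\<^sub>R (Z i - s)\<close>, so only
    coordinate i moves away from y and \<open>f_coord\<close> applies.\<close>
  have X_alt: "X i = y + (\<sigma> * h i) *\<^sub>R axis i 1" for i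
  proof -
    have "Z i - s = h i *\<^sub>R axis i 1"
      using Zs[of i] by (auto simp: vec_eq_iff prox_step_def h_def axis_def)
    moreover have "X i = y + \<sigma> *\<^sub>R (Z i - s)"
      by (simp add: X s_def \<sigma>_def algebra_simps)
    ultimately show ?thesis by simp
  qed
  have sum_f: "(\<Sum>i\<in>UNIV. f (X i))
      \<le> N * f y + \<sigma> * (\<Sum>i\<in>UNIV. grad y $ i * h i) + \<mu> / 2 * (\<Sum>i\<in>UNIV. L i * (h i)\<^sup>2)"
  proof -
    have "(\<Sum>i\<in>UNIV. f (X i)) \<le> (\<Sum>i\<in>UNIV. f y + \<sigma> * (grad y $ i * h i) + \<mu> / 2 * (L i * (h i)\<^sup>2))"
    proof (rule sum_mono)
      fix i
      show "f (X i) \<le> f y + \<sigma> * (grad y $ i * h i) + \<mu> / 2 * (L i * (h i)\<^sup>2)"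
        using f_coord[of y "\<sigma> * h i" i]
        by (simp add: X_alt \<sigma>(4) power_mult_distrib power2_eq_square mult_ac)
    qed
    then show ?thesis by (simp add: sum.distrib sum_distrib_left N_def)
  qed
  have sum_Psi: "(\<Sum>i\<in>UNIV. Psi (Z i)) = (N - 1) * Psi s + (\<Sum>i\<in>UNIV. p i (Z i $ i))"
    unfolding Psi_def N_def by (rule prox_step_sum[OF Zs])
  have sum_norm: "(\<Sum>i\<in>UNIV. (weighted_norm L (Z i - xs))\<^sup>2)
      = (N - 1) * (weighted_norm L (s - xs))\<^sup>2 + (\<Sum>i\<in>UNIV. L i * (Z i $ i - xs $ i)\<^sup>2)"
    using prox_step_sum[OF Zs, of "\<lambda>j v. L j * (v - xs $ j)\<^sup>2"]
    by (simp add: weighted_norm_sq N_def)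
  \<comment> \<open>Coordinate i is tested at \<open>xs $ i\<close>; summing over all i rebuilds the
    full \<open>Psi xs\<close> and the full inner product with the gradient.\<close>
  have prox: "(\<Sum>i\<in>UNIV. p i (Z i $ i)) + (\<Sum>i\<in>UNIV. grad y $ i * h i)
        + \<sigma> / 2 * (\<Sum>i\<in>UNIV. L i * (h i)\<^sup>2) + \<sigma> / 2 * (\<Sum>i\<in>UNIV. L i * (Z i $ i - xs $ i)\<^sup>2)
      \<le> Psi xs + grad y \<bullet> (xs - s) + \<sigma> / 2 * (weighted_norm L (s - xs))\<^sup>2"
  proof -
    have "(\<Sum>i\<in>UNIV. p i (Z i $ i) + grad y $ i * h i
        + \<sigma> / 2 * (L i * (h i)\<^sup>2) + \<sigma> / 2 * (L i * (Z i $ i - xs $ i)\<^sup>2))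
      \<le> (\<Sum>i\<in>UNIV. p i (xs $ i) + grad y $ i * (xs $ i - s $ i)
        + \<sigma> / 2 * (L i * (s $ i - xs $ i)\<^sup>2))"
    proof (rule sum_mono)
      fix i
      have "p i (Z i $ i) + grad y $ i * Z i $ i + \<sigma> * L i / 2 * (Z i $ i - s $ i)\<^sup>2
          + \<sigma> * L i / 2 * (xs $ i - Z i $ i)\<^sup>2
        \<le> p i (xs $ i) + grad y $ i * xs $ i + \<sigma> * L i / 2 * (xs $ i - s $ i)\<^sup>2"
        using Zs[of i] xs unfolding prox_step_def Dom_def \<sigma>_def by blast
      then show "p i (Z i $ i) + grad y $ i * h i
          + \<sigma> / 2 * (L i * (h i)\<^sup>2) + \<sigma> / 2 * (L i * (Z i $ i - xs $ i)\<^sup>2)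
        \<le> p i (xs $ i) + grad y $ i * (xs $ i - s $ i) + \<sigma> / 2 * (L i * (s $ i - xs $ i)\<^sup>2)"
        by (simp add: h_def power2_commute[of "xs $ i"] algebra_simps)
    qed
    then show ?thesis
      by (simp add: sum.distrib sum_distrib_left Psi_def weighted_norm_sq inner_vec_def)
  qed
  have norm_s: "(weighted_norm L (s - xs))\<^sup>2
      \<le> (1 - \<alpha>) * (weighted_norm L (z - xs))\<^sup>2 + \<alpha> * (weighted_norm L (y - xs))\<^sup>2"
  proof -
    have "s - xs = (1 - \<alpha>) *\<^sub>R (z - xs) + \<alpha> *\<^sub>R (y - xs)"
      unfolding s_def by (simp add: algebra_simps)
    then show ?thesis using weighted_norm_sq_convex[of \<alpha> "z - xs" "y - xs"] \<alpha> by simp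
  qed
  have f_xs: "f y + grad y \<bullet> (xs - y) + \<mu> / 2 * (weighted_norm L (y - xs))\<^sup>2 \<le> f xs"
  proof -
    have "(weighted_norm L (xs - y))\<^sup>2 = (weighted_norm L (y - xs))\<^sup>2"
      by (simp add: weighted_norm_sq power2_commute)
    then show ?thesis using f_strong[of y "xs - y"] by simp
  qed
  have f_x: "f y + grad y \<bullet> (x - y) \<le> f x"
  proof -
    have "0 \<le> \<mu> / 2 * (weighted_norm L (x - y))\<^sup>2" using mu by simp
    then show ?thesis using f_strong[of y "x - y"] by simp
  qed
  \<comment> \<open>As y lies between x and s, the direction to xs splits into the two directions
    covered by \<open>f_xs\<close> and \<open>f_x\<close>.\<close>
  have grad_eq: "\<alpha> * (grad y \<bullet> (xs - s)) = \<alpha> * (grad y \<bullet> (xs - y)) + (1 - \<alpha>) * (grad y \<bullet> (x - y))"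
  proof -
    have "\<alpha> *\<^sub>R (xs - s) = \<alpha> *\<^sub>R (xs - y) + (1 - \<alpha>) *\<^sub>R (x - y)"
      using y_alt by (simp add: algebra_simps)
    then have "grad y \<bullet> (\<alpha> *\<^sub>R (xs - s))
        = grad y \<bullet> (\<alpha> *\<^sub>R (xs - y)) + grad y \<bullet> ((1 - \<alpha>) *\<^sub>R (x - y))"
      by (simp only: inner_add_right)
    then show ?thesis by (simp only: inner_scaleR_right)
  qed
  define PZ GH EH EZ PS ES GS E Ey where
    "PZ = (\<Sum>i\<in>UNIV. p i (Z i $ i))" and "GH = (\<Sum>i\<in>UNIV. grad y $ i * h i)"
    and "EH = (\<Sum>i\<in>UNIV. L i * (h i)\<^sup>2)" and "EZ = (\<Sum>i\<in>UNIV. L i * (Z i $ i - xs $ i)\<^sup>2)"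
    and "PS = Psi s" and "ES = (weighted_norm L (s - xs))\<^sup>2" and "GS = grad y \<bullet> (xs - s)"
    and "E = (weighted_norm L (z - xs))\<^sup>2" and "Ey = (weighted_norm L (y - xs))\<^sup>2"
  define Gxs Gx Pz Pxs where "Gxs = grad y \<bullet> (xs - y)" and "Gx = grad y \<bullet> (x - y)"
    and "Pz = Psi z" and "Pxs = Psi xs"
  note folds = PZ_def[symmetric] GH_def[symmetric] EH_def[symmetric] EZ_def[symmetric]
    PS_def[symmetric] ES_def[symmetric] GS_def[symmetric] E_def[symmetric] Ey_def[symmetric]
    Gxs_def[symmetric] Gx_def[symmetric] Pz_def[symmetric] Pxs_def[symmetric]
  define a m where "a = \<alpha>" and "m = \<mu> / 2"
  define Q F where "Q = (1 - \<sigma>) * ((1 - b) * q + b * Pz)" and "F = f xs + Pxs"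
  have "(\<Sum>i\<in>UNIV. potential xs (X i) (Z i) ((1 - b) * q + b * Pz))
      = (\<Sum>i\<in>UNIV. f (X i)) + \<sigma> * (\<Sum>i\<in>UNIV. Psi (Z i)) + N * Q
        + \<mu> / 2 * (\<Sum>i\<in>UNIV. (weighted_norm L (Z i - xs))\<^sup>2) - N * F"
    unfolding potential_def
    by (simp add: sum.distrib sum_subtractf sum_distrib_left N_def \<sigma>_def Pxs_def Q_def F_def)
  also have "\<dots> \<le> (N * f y + \<sigma> * GH + \<mu> / 2 * EH) + \<sigma> * ((N - 1) * PS + PZ)
        + N * Q + \<mu> / 2 * ((N - 1) * ES + EZ) - N * F"
    using sum_f unfolding sum_Psi sum_norm folds by linarith
  also have "\<dots> = N * f y + \<sigma> * (PZ + GH + \<sigma> / 2 * EH + \<sigma> / 2 * EZ) + \<sigma> * (N - 1) * PS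
        + N * Q + \<mu> / 2 * (N - 1) * ES - N * F"
    unfolding \<sigma>(4) by (simp add: field_simps)
  \<comment> \<open>The prox bound enters with the factor \<sigma>, because
    \<open>\<sigma> * (\<sigma> / 2) = \<mu> / 2\<close> matches the weighted norm terms.\<close>
  also have "\<dots> \<le> N * f y + \<sigma> * (Pxs + GS + \<sigma> / 2 * ES) + \<sigma> * (N - 1) * PS
        + N * Q + \<mu> / 2 * (N - 1) * ES - N * F"
    using mult_left_mono[OF prox[unfolded folds], of \<sigma>] \<sigma>(1) by linarith
  also have "\<dots> = N * (f y + \<alpha> * (Pxs + GS) + \<mu> / 2 * ES - F)
        + (\<sigma> * (N - 1) * PS + N * Q)"
    unfolding a_def[symmetric] unfolding \<sigma>(4) unfolding \<sigma>(3)[folded a_def] by (simp add: field_simps)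
  also have "\<dots> \<le> N * (f y + \<alpha> * (Pxs + GS) + \<mu> / 2 * ES - F)
        + N * ((1 - \<alpha>) * (\<sigma> * Pz + (1 - \<sigma>) * q))"
  proof -
    \<comment> \<open>Multiplying by 1 + \<alpha> clears the denominators. Once \<open>Psi_s\<close>
      is inserted, the coefficients of \<open>Pz\<close> and of \<open>q\<close> agree exactly
      because \<open>\<sigma> = N * \<alpha>\<close>.\<close>
    have b: "(1 + \<alpha>) * b = \<alpha> * (1 + \<sigma>)" using \<alpha> by (simp add: b_def \<sigma>_def)
    have b': "(1 + \<alpha>) * Q
        = (1 - \<sigma>) * ((1 - \<alpha> * \<sigma>) * q + \<alpha> * (1 + \<sigma>) * Pz)"
    proof -
      have "(1 + \<alpha>) * Q
          = (1 - \<sigma>) * ((1 + \<alpha> - (1 + \<alpha>) * b) * q + (1 + \<alpha>) * b * Pz)"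
        unfolding Q_def by (simp add: algebra_simps)
      then show ?thesis unfolding b by (simp add: algebra_simps)
    qed
    have "(1 + \<alpha>) * (\<sigma> * (N - 1) * PS + N * Q)
        = \<sigma> * (N - 1) * ((1 + \<alpha>) * PS) + N * ((1 + \<alpha>) * Q)"
      by (simp add: algebra_simps)
    also have "\<dots> \<le> \<sigma> * (N - 1) * (\<alpha> * (\<sigma> * Pz + (1 - \<sigma>) * q) + Pz)
        + N * ((1 - \<sigma>) * ((1 - \<alpha> * \<sigma>) * q + \<alpha> * (1 + \<sigma>) * Pz))"
      using mult_left_mono[OF Psi_s[unfolded folds], of "\<sigma> * (N - 1)"] \<sigma>(1,2) N unfolding b' by simp
    also have "\<dots> = (1 + \<alpha>) * (N * ((1 - \<alpha>) * (\<sigma> * Pz + (1 - \<sigma>) * q)))"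
      unfolding \<sigma>(3) by (simp add: algebra_simps)
    finally show ?thesis using \<alpha> by simp
  qed
  also have "\<dots> = N * (f y + \<alpha> * GS + \<mu> / 2 * ES - f xs - (1 - \<alpha>) * Pxs
        + (1 - \<alpha>) * (\<sigma> * Pz + (1 - \<sigma>) * q))"
    by (simp add: F_def algebra_simps)
  also have "\<dots> \<le> N * ((1 - \<alpha>) * (f x + \<sigma> * Pz + (1 - \<sigma>) * q + \<mu> / 2 * E - F))"
  proof (rule mult_left_mono)
    have 1: "\<mu> / 2 * ES \<le> \<mu> / 2 * ((1 - \<alpha>) * E + \<alpha> * Ey)"
      using mult_left_mono[OF norm_s[unfolded folds], of "\<mu> / 2"] mu by simp
    have 2: "\<alpha> * (f y + Gxs + \<mu> / 2 * Ey) \<le> \<alpha> * f xs"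
      using mult_left_mono[OF f_xs[unfolded folds], of \<alpha>] \<alpha> by simp
    have 3: "(1 - \<alpha>) * (f y + Gx) \<le> (1 - \<alpha>) * f x"
      using mult_left_mono[OF f_x[unfolded folds], of "1 - \<alpha>"] \<alpha> by simp
    show "f y + \<alpha> * GS + \<mu> / 2 * ES - f xs - (1 - \<alpha>) * Pxs + (1 - \<alpha>) * (\<sigma> * Pz + (1 - \<sigma>) * q)
      \<le> (1 - \<alpha>) * (f x + \<sigma> * Pz + (1 - \<sigma>) * q + \<mu> / 2 * E - F)"
      using 1 2 3 unfolding grad_eq[unfolded folds] F_def m_def[symmetric] by (simp add: algebra_simps)
  qed (use N in simp)
  finally show ?thesis
    by (simp add: potential_def N_def \<sigma>_def E_def Pz_def Pxs_def F_def mult.assoc)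
qed

section \<open>Iterates along a given index sequence\<close>

definition trajectory ::
  "real ^ 'n \<Rightarrow> (nat \<Rightarrow> 'n) \<Rightarrow> (nat \<Rightarrow> real ^ 'n) \<Rightarrow> (nat \<Rightarrow> real ^ 'n) \<Rightarrow> (nat \<Rightarrow> real ^ 'n) \<Rightarrow> bool"
where
  "trajectory x0 idx x y z \<longleftrightarrow> x 0 = x0 \<and> z 0 = x0 \<and> (\<forall>k.
     y k = (1 / (1 + \<alpha>)) *\<^sub>R (x k + \<alpha> *\<^sub>R z k) \<and>
     prox_step (idx k) (y k) ((1 - \<alpha>) *\<^sub>R z k + \<alpha> *\<^sub>R y k) (z (Suc k)) \<and>
     x (Suc k) = y k + sqrt \<mu> *\<^sub>R (z (Suc k) - z k) + (sqrt \<mu> * \<alpha>) *\<^sub>R (z k - y k))"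

text \<open>By induction with \<open>prox_step_unique\<close>, the state at time k depends on the
  first k indices alone. This is the adaptedness needed for the expectation.\<close>

lemma trajectory_unique:
  assumes "trajectory x0 idx x y z" "trajectory x0 idx' x' y' z'" "\<And>j. j < k \<Longrightarrow> idx j = idx' j"
  shows "x k = x' k" "z k = z' k"
proof -
  have "(\<forall>j<k. idx j = idx' j) \<longrightarrow> x k = x' k \<and> z k = z' k"
  proof (induction k)
    case (Suc k)
    show ?case
    proof
      assume idx: "\<forall>j<Suc k. idx j = idx' j"
      then have eq: "x k = x' k" "z k = z' k" using Suc by auto
      then have y: "y k = y' k" using assms unfolding trajectory_def by simp
      have "prox_step (idx k) (y k) ((1 - \<alpha>) *\<^sub>R z k + \<alpha> *\<^sub>R y k) (z (Suc k))"
        "prox_step (idx k) (y k) ((1 - \<alpha>) *\<^sub>R z k + \<alpha> *\<^sub>R y k) (z' (Suc k))"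
        using assms idx eq y unfolding trajectory_def by (blast, metis lessI)
      then have "z (Suc k) = z' (Suc k)" by (rule prox_step_unique)
      then show "x (Suc k) = x' (Suc k) \<and> z (Suc k) = z' (Suc k)"
        using assms eq y unfolding trajectory_def by simp
    qed
  qed (use assms in \<open>simp add: trajectory_def\<close>)
  then show "x k = x' k" "z k = z' k" using assms(3) by auto
qed

text \<open>The representation of x by z and an average of earlier z keeps x in the domain. At time
  0 all three points are x0; afterwards it persists by the choice of b.\<close>

lemma trajectory_invariant:
  assumes tr: "trajectory x0 idx x y z" and x0: "x0 \<in> Dom"
  shows "z k \<in> Dom \<and> averaged b z k \<in> Dom \<and> Psi (averaged b z k) \<le> averaged b (Psi \<circ> z) k
    \<and> x k = sqrt \<mu> *\<^sub>R z k + (1 - sqrt \<mu>) *\<^sub>R averaged b z k"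
proof (induction k)
  case 0
  show ?case using tr x0 by (simp add: trajectory_def flip: scaleR_add_left)
next
  case (Suc k)
  define w where "w = averaged b z k"
  have z: "z k \<in> Dom" and w: "w \<in> Dom" "Psi w \<le> averaged b (Psi \<circ> z) k"
    and x: "x k = sqrt \<mu> *\<^sub>R z k + (1 - sqrt \<mu>) *\<^sub>R w"
    using Suc by (auto simp: w_def o_def)
  have y: "y k = (1 / (1 + \<alpha>)) *\<^sub>R (x k + \<alpha> *\<^sub>R z k)"
    and st: "prox_step (idx k) (y k) ((1 - \<alpha>) *\<^sub>R z k + \<alpha> *\<^sub>R y k) (z (Suc k))"
    and x': "x (Suc k) = y k + sqrt \<mu> *\<^sub>R (z (Suc k) - z k) + (sqrt \<mu> * \<alpha>) *\<^sub>R (z k - y k)"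
    using tr unfolding trajectory_def by blast+
  have "x k \<in> Dom"
    using Dom_convex[OF w(1) z, of "sqrt \<mu>"] sqrt_mu by (simp add: x add.commute)
  moreover note extrapolation_combination(1)[OF \<alpha>_bounds(1) y]
  ultimately have "(1 - \<alpha>) *\<^sub>R z k + \<alpha> *\<^sub>R y k \<in> Dom"
    using Dom_convex[OF _ z, of "x k" "1 / (1 + \<alpha>)"] \<alpha>_bounds by simp
  \<comment> \<open>Off the selected coordinate the new z agrees with the prox centre, which lies in
    \<open>Dom\<close>; at that coordinate \<open>prox_step\<close> includes membership.\<close>
  then have "z (Suc k) \<in> Dom"
    using st unfolding prox_step_def Dom_def by (smt (verit) mem_Collect_eq)
  moreover have "averaged b z (Suc k) \<in> Dom"
    using Dom_convex[OF w(1) z] b_bounds by (simp add: w_def)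
  moreover have "Psi (averaged b z (Suc k)) \<le> averaged b (Psi \<circ> z) (Suc k)"
  proof -
    have "Psi (averaged b z (Suc k)) \<le> (1 - b) * Psi w + b * Psi (z k)"
      using Psi_convex[OF w(1) z] b_bounds by (simp add: w_def)
    also have "\<dots> \<le> (1 - b) * averaged b (Psi \<circ> z) k + b * Psi (z k)"
      using w(2) b_bounds by (simp add: mult_left_mono)
    finally show ?thesis by simp
  qed
  moreover have "x (Suc k) = sqrt \<mu> *\<^sub>R z (Suc k) + (1 - sqrt \<mu>) *\<^sub>R averaged b z (Suc k)"
  proof -
    have "x (Suc k) $ i = sqrt \<mu> * z (Suc k) $ i
        + (1 - sqrt \<mu>) * ((1 - b) * w $ i + b * z k $ i)" for i
    proof -
      have "(1 + \<alpha>) * b = \<alpha> * (1 + sqrt \<mu>)" using \<alpha>_bounds by (simp add: b_def)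
      moreover have "(1 + \<alpha>) * y k $ i = x k $ i + \<alpha> * z k $ i" using \<alpha>_bounds by (simp add: y)
      moreover have "x k $ i = sqrt \<mu> * z k $ i + (1 - sqrt \<mu>) * w $ i" by (simp add: x)
      moreover have "x (Suc k) $ i = y k $ i + sqrt \<mu> * (z (Suc k) $ i - z k $ i)
          + (sqrt \<mu> * \<alpha>) * (z k $ i - y k $ i)" by (simp add: x')
      ultimately have "(1 + \<alpha>) * x (Suc k) $ i
          = (1 + \<alpha>) * (sqrt \<mu> * z (Suc k) $ i + (1 - sqrt \<mu>) * ((1 - b) * w $ i + b * z k $ i))"
        by algebra
      then show ?thesis using \<alpha>_bounds by simp
    qed
    then show ?thesis by (simp add: vec_eq_iff w_def)
  qed
  ultimately show ?case by blast
qed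

end

subsection \<open>Expectation over the selected coordinates\<close>

lemma (in prob_space) iid_uniform_prob_history:
  assumes "iid_uniform M (I :: nat \<Rightarrow> 'a \<Rightarrow> 'n::finite)"
  shows "{\<omega> \<in> space M. \<forall>j<k. I j \<omega> = l j} \<in> events"
    and "prob {\<omega> \<in> space M. \<forall>j<k. I j \<omega> = l j} = (1 / real CARD('n)) ^ k"
proof -
  have indep: "indep_vars (\<lambda>_. count_space UNIV) I UNIV"
    and unif: "distr M (count_space UNIV) (I j) = uniform_count_measure UNIV" for j
    using assms by (auto simp: iid_uniform_def)
  have meas: "I j \<in> measurable M (count_space UNIV)" for j
    using indep by (auto simp: indep_vars_def2)
  show "{\<omega> \<in> space M. \<forall>j<k. I j \<omega> = l j} \<in> events"
    using meas by measurable
  have single: "prob (I j -` {i} \<inter> space M) = 1 / real CARD('n)" for j i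
    using measure_distr[OF meas, of "{i}" j] by (simp add: unif measure_uniform_count_measure)
  show "prob {\<omega> \<in> space M. \<forall>j<k. I j \<omega> = l j} = (1 / real CARD('n)) ^ k"
  \<comment> \<open>The empty history is treated apart because \<open>indep_varsD\<close> requires a
    nonempty index set.\<close>
  proof (cases "k = 0")
    case True
    then show ?thesis by (simp add: prob_space)
  next
    case False
    then have "{\<omega> \<in> space M. \<forall>j<k. I j \<omega> = l j} = (\<Inter>j\<in>{..<k}. I j -` {l j} \<inter> space M)"
      by auto
    also have "prob \<dots> = (\<Prod>j\<in>{..<k}. prob (I j -` {l j} \<inter> space M))"
      by (rule indep_varsD[OF indep]) (use False in auto)
    finally show ?thesis by (simp add: single)
  qed
qed

text \<open>Every history of selected indices has positive probability, hence occurs at some sample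
  point. This is what provides the subproblem solutions for the indices that were not drawn.\<close>

lemma (in prob_space) nn_integral_descent:
  fixes I :: "nat \<Rightarrow> 'a \<Rightarrow> 'n::finite" and V :: "nat \<Rightarrow> 'a \<Rightarrow> real"
  assumes iid: "iid_uniform M I" and c: "c \<ge> 0"
    and nonneg: "\<And>k \<omega>. \<omega> \<in> space M \<Longrightarrow> V k \<omega> \<ge> 0"
    and adapted: "\<And>k \<omega> \<omega>'. \<omega> \<in> space M \<Longrightarrow> \<omega>' \<in> space M \<Longrightarrow>
      (\<And>j. j < k \<Longrightarrow> I j \<omega> = I j \<omega>') \<Longrightarrow> V k \<omega> = V k \<omega>'"
    and descent: "\<And>k W i0. (\<And>i. W i \<in> space M) \<Longrightarrow>
      (\<And>i i' j. j < k \<Longrightarrow> I j (W i) = I j (W i')) \<Longrightarrow> (\<And>i. I k (W i) = i) \<Longrightarrow>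
      (\<Sum>i\<in>UNIV. V (Suc k) (W i)) \<le> real CARD('n) * c * V k (W i0)"
    and init: "\<And>\<omega>. \<omega> \<in> space M \<Longrightarrow> V 0 \<omega> \<le> C"
  shows "(\<integral>\<^sup>+ \<omega>. ennreal (V k \<omega>) \<partial>M) \<le> ennreal (c ^ k * C)"
proof -
  define n where "n = real CARD('n)"
  have n: "n > 0" by (simp add: n_def)
  define H where "H k l = {\<omega> \<in> space M. \<forall>j<k. I j \<omega> = l ! j}" for k and l :: "'n list"
  have H_meas: "H k l \<in> events" for k l
    unfolding H_def by (rule iid_uniform_prob_history(1)[OF iid])
  have H_prob: "prob (H k l) = (1 / n) ^ k" for k l
    unfolding H_def n_def by (rule iid_uniform_prob_history(2)[OF iid])
  define wit where "wit l = (SOME \<omega>. \<omega> \<in> H (length l) l)" for l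
  have wit: "wit l \<in> H (length l) l" for l
  proof -
    have "prob (H (length l) l) > 0" using n by (simp add: H_prob)
    then have "H (length l) l \<noteq> {}" by auto
    then show ?thesis unfolding wit_def by (simp add: some_in_eq)
  qed
  define lists where "lists k = {l :: 'n list. length l = k}" for k
  have fin: "finite (lists k)" for k
    using finite_lists_length_eq[of "UNIV :: 'n set" k] by (simp add: lists_def)
  \<comment> \<open>Each history has probability \<open>(1 / n) ^ k\<close>, so this sum is
    \<open>n ^ k\<close> times the expectation and grows by at most \<open>n * c\<close> per
    step.\<close>
  define T where "T k = (\<Sum>l\<in>lists k. V k (wit l))" for k
  have T: "T k \<le> (n * c) ^ k * C" for k
  proof (induction k)
    case 0
    have "lists 0 = {[]}" by (auto simp: lists_def)
    then show ?case using init wit[of "[]"] by (simp add: T_def H_def)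
  next
    case (Suc k)
    have "lists (Suc k) = (\<lambda>(l, i). l @ [i]) ` (lists k \<times> UNIV)"
    proof (intro set_eqI iffI)
      fix l assume "l \<in> lists (Suc k)"
      then have "(butlast l, last l) \<in> lists k \<times> UNIV" "l = butlast l @ [last l]"
        by (auto simp: lists_def simp flip: length_greater_0_conv)
      then show "l \<in> (\<lambda>(l, i). l @ [i]) ` (lists k \<times> UNIV)"
        by (metis (mono_tags, lifting) image_eqI old.prod.case)
    qed (auto simp: lists_def)
    then have "T (Suc k) = (\<Sum>(l, i)\<in>lists k \<times> UNIV. V (Suc k) (wit (l @ [i])))"
      unfolding T_def
      by (simp, subst sum.reindex) (auto intro!: inj_onI sum.cong)
    also have "\<dots> = (\<Sum>l\<in>lists k. \<Sum>i\<in>UNIV. V (Suc k) (wit (l @ [i])))"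
      by (simp add: sum.cartesian_product)
    also have "\<dots> \<le> (\<Sum>l\<in>lists k. n * c * V k (wit l))"
    proof (rule sum_mono)
      fix l assume l: "l \<in> lists k"
      define W where "W i = wit (l @ [i])" for i
      have W: "W i \<in> space M" "I k (W i) = i" "\<And>j. j < k \<Longrightarrow> I j (W i) = l ! j" for i
        using wit[of "l @ [i]"] l by (auto simp: W_def H_def lists_def nth_append)
      \<comment> \<open>Here \<open>undefined\<close> is an arbitrary index: all \<open>W i\<close>
        share the first k selections, so \<open>V k\<close> agrees on them and on
        \<open>wit l\<close>.\<close>
      have "(\<Sum>i\<in>UNIV. V (Suc k) (W i)) \<le> n * c * V k (W undefined)"
        unfolding n_def by (rule descent) (use W in auto)
      also have "V k (W undefined) = V k (wit l)"
        by (rule adapted) (use W wit[of l] l in \<open>auto simp: H_def lists_def\<close>)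
      finally show "(\<Sum>i\<in>UNIV. V (Suc k) (wit (l @ [i]))) \<le> n * c * V k (wit l)"
        by (simp add: W_def)
    qed
    also have "\<dots> = n * c * T k" by (simp add: T_def sum_distrib_left)
    also have "\<dots> \<le> n * c * ((n * c) ^ k * C)"
      using Suc n c by (intro mult_left_mono) auto
    finally show ?case by (simp add: mult_ac)
  qed
  \<comment> \<open>By \<open>adapted\<close>, \<open>V k\<close> is constant on each history event,
    so the integrand is a simple function; its measurability comes from this form.\<close>
  have "(\<integral>\<^sup>+ \<omega>. ennreal (V k \<omega>) \<partial>M)
      = (\<integral>\<^sup>+ \<omega>. (\<Sum>l\<in>lists k. ennreal (V k (wit l)) * indicator (H k l) \<omega>) \<partial>M)"
  proof (rule nn_integral_cong)
    fix \<omega> assume \<omega>: "\<omega> \<in> space M"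
    define h where "h = map (\<lambda>j. I j \<omega>) [0..<k]"
    have h: "h \<in> lists k" by (simp add: h_def lists_def)
    have in_H: "\<omega> \<in> H k l \<longleftrightarrow> l = h" if "l \<in> lists k" for l
      using that \<omega> by (auto simp: H_def h_def lists_def list_eq_iff_nth_eq)
    have "(\<Sum>l\<in>lists k. ennreal (V k (wit l)) * indicator (H k l) \<omega>)
        = (\<Sum>l\<in>lists k. if l = h then ennreal (V k (wit l)) else 0)"
      by (rule sum.cong) (auto simp: in_H indicator_def)
    also have "\<dots> = ennreal (V k (wit h))" using fin h by simp
    also have "V k (wit h) = V k \<omega>"
      by (rule adapted) (use \<omega> wit[of h] in \<open>auto simp: H_def h_def\<close>)
    finally show "ennreal (V k \<omega>)
        = (\<Sum>l\<in>lists k. ennreal (V k (wit l)) * indicator (H k l) \<omega>)" by simp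
  qed
  also have "\<dots> = (\<Sum>l\<in>lists k. ennreal (V k (wit l)) * emeasure M (H k l))"
    using H_meas by (subst nn_integral_sum) (auto simp: nn_integral_cmult_indicator)
  also have "\<dots> = (\<Sum>l\<in>lists k. ennreal (V k (wit l) * (1 / n) ^ k))"
    using n by (intro sum.cong refl) (simp add: emeasure_eq_measure H_prob ennreal_mult'')
  also have "\<dots> = ennreal ((1 / n) ^ k * T k)"
  proof -
    have "0 \<le> V k (wit l)" for l using nonneg wit[of l] by (auto simp: H_def)
    then show ?thesis using n by (subst sum_ennreal) (auto simp: T_def sum_distrib_left mult_ac)
  qed
  also have "\<dots> \<le> ennreal ((1 / n) ^ k * ((n * c) ^ k * C))"
    using T[of k] n by (intro ennreal_leI mult_left_mono) auto
  also have "(1 / n) ^ k * ((n * c) ^ k * C) = c ^ k * C"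
    using n by (simp add: power_mult_distrib power_divide)
  finally show ?thesis .
qed

subsection \<open>The dual problem\<close>

lemma conjugate_neq_MInfty: "conjugate f u \<noteq> - \<infinity>"
  using conjugate_ge[of u 0 f] by auto

lemma separable_part_cases:
  fixes \<phi> :: "'n::finite \<Rightarrow> real \<Rightarrow> real"
  obtains (infinite) "conjugate (\<phi> i) (- u) = \<infinity>" "separable_part \<phi> \<gamma> i u = \<infinity>"
  | (finite) c where "conjugate (\<phi> i) (- u) = ereal c"
      "separable_part \<phi> \<gamma> i u = ereal (1 / real CARD('n) * (c - \<gamma> / 2 * u\<^sup>2))"
proof (cases "conjugate (\<phi> i) (- u)")
  case (real c)
  then show ?thesis using that(2)[of c] by (simp add: separable_part_def)
next
  case PInf
  then show ?thesis using that(1) by (simp add: separable_part_def)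
next
  case MInf
  then show ?thesis using conjugate_neq_MInfty by auto
qed

text \<open>The conjugate is strongly convex with modulus \<gamma>, exactly what subtracting the
  quadratic uses up; the reflection u to -u is harmless. Convexity of the effective domain is proved
  along with the inequality.\<close>

lemma separable_part_convex:
  fixes \<phi> :: "'n::finite \<Rightarrow> real \<Rightarrow> real"
  assumes sm: "lipschitz_smooth (1 / \<gamma>) (\<phi> i)" and \<gamma>: "\<gamma> > 0"
  shows "convex_on {u. separable_part \<phi> \<gamma> i u \<noteq> \<infinity>} (\<lambda>u. real_of_ereal (separable_part \<phi> \<gamma> i u))"
proof -
  define n where "n = real CARD('n)"
  have n: "n > 0" by (simp add: n_def)
  have key: "separable_part \<phi> \<gamma> i ((1 - t) * u + t * v) \<noteq> \<infinity> \<and>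
      real_of_ereal (separable_part \<phi> \<gamma> i ((1 - t) * u + t * v))
      \<le> (1 - t) * real_of_ereal (separable_part \<phi> \<gamma> i u) + t * real_of_ereal (separable_part \<phi> \<gamma> i v)"
    if u: "separable_part \<phi> \<gamma> i u \<noteq> \<infinity>" and v: "separable_part \<phi> \<gamma> i v \<noteq> \<infinity>"
      and t: "0 \<le> t" "t \<le> 1" for u v t
  proof -
    obtain a where a: "conjugate (\<phi> i) (- u) = ereal a"
        "separable_part \<phi> \<gamma> i u = ereal (1 / n * (a - \<gamma> / 2 * u\<^sup>2))"
      using separable_part_cases[of \<phi> i u \<gamma>] u unfolding n_def by metis
    obtain b where b: "conjugate (\<phi> i) (- v) = ereal b"
        "separable_part \<phi> \<gamma> i v = ereal (1 / n * (b - \<gamma> / 2 * v\<^sup>2))"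
      using separable_part_cases[of \<phi> i v \<gamma>] v unfolding n_def by metis
    define w where "w = (1 - t) * u + t * v"
    have "conjugate (\<phi> i) (- w)
        \<le> ereal ((1 - t) * a + t * b - \<gamma> / 2 * t * (1 - t) * (- u - - v)\<^sup>2)"
      using conjugate_lipschitz_smooth[OF sm \<gamma>, of "- u" a "- v" b t] a b t
      by (simp add: w_def algebra_simps)
    then obtain c where c: "c \<le> (1 - t) * a + t * b - \<gamma> / 2 * t * (1 - t) * (u - v)\<^sup>2"
        "separable_part \<phi> \<gamma> i w = ereal (1 / n * (c - \<gamma> / 2 * w\<^sup>2))"
      using separable_part_cases[of \<phi> i w \<gamma>] unfolding n_def
      by (metis (no_types, lifting) PInfty_neq_ereal(1) ereal_infty_less_eq(1) ereal_less_eq(3)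
          minus_diff_minus power2_minus)
    have "c - \<gamma> / 2 * w\<^sup>2 \<le> (1 - t) * (a - \<gamma> / 2 * u\<^sup>2) + t * (b - \<gamma> / 2 * v\<^sup>2)"
      using c(1) by (simp add: w_def power2_eq_square field_simps)
    then have "1 / n * (c - \<gamma> / 2 * w\<^sup>2)
        \<le> 1 / n * ((1 - t) * (a - \<gamma> / 2 * u\<^sup>2) + t * (b - \<gamma> / 2 * v\<^sup>2))"
      using n by (intro mult_left_mono) auto
    also have "\<dots> = (1 - t) * (1 / n * (a - \<gamma> / 2 * u\<^sup>2)) + t * (1 / n * (b - \<gamma> / 2 * v\<^sup>2))"
      by (simp only: distrib_left mult.left_commute)
    finally show ?thesis
      unfolding w_def[symmetric] a(2) b(2) c(2) by simp
  qed
  show ?thesis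
  proof (rule convex_onI)
    show "convex {u. separable_part \<phi> \<gamma> i u \<noteq> \<infinity>}"
      unfolding convex_alt using key by auto
  qed (use key in auto)
qed

lemma power2_norm_vec: "(norm (x :: real ^ 'n::finite))\<^sup>2 = (\<Sum>i\<in>UNIV. (x $ i)\<^sup>2)"
  by (simp add: norm_vec_def L2_set_def sum_nonneg)

text \<open>The quadratic added to the smooth part cancels those subtracted from the separable
  terms.\<close>

lemma dual_objective_eq:
  fixes A :: "real ^ 'n::finite ^ 'd::finite" and \<phi> :: "'n \<Rightarrow> real \<Rightarrow> real"
  assumes g: "strongly_convex 1 g"
    and fin: "\<And>i. separable_part \<phi> \<gamma> i (x $ i) \<noteq> \<infinity>"
  shows "dual_objective \<phi> g A lam x = ereal (- (smooth_part g A lam \<gamma> x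
    + (\<Sum>i\<in>UNIV. real_of_ereal (separable_part \<phi> \<gamma> i (x $ i)))))"
proof -
  obtain G where G: "\<And>u. conjugate g u = ereal (G u)"
    using conjugate_strongly_convex[OF g] by (metis zero_less_one)
  define n where "n = real CARD('n)"
  have n: "n > 0" by (simp add: n_def)
  have "\<exists>c. conjugate (\<phi> i) (- (x $ i)) = ereal c \<and>
      separable_part \<phi> \<gamma> i (x $ i) = ereal (1 / n * (c - \<gamma> / 2 * (x $ i)\<^sup>2))" for i
    using separable_part_cases[of \<phi> i "x $ i" \<gamma>] fin[of i] unfolding n_def by metis
  then obtain c where c: "\<And>i. conjugate (\<phi> i) (- (x $ i)) = ereal (c i)"
      "\<And>i. separable_part \<phi> \<gamma> i (x $ i) = ereal (1 / n * (c i - \<gamma> / 2 * (x $ i)\<^sup>2))"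
    by metis
  have "(\<Sum>i\<in>UNIV. 1 / n * (c i - \<gamma> / 2 * (x $ i)\<^sup>2))
      = 1 / n * (\<Sum>i\<in>UNIV. c i) - \<gamma> / (2 * n) * (norm x)\<^sup>2"
    by (simp add: power2_norm_vec sum_subtractf sum_distrib_left right_diff_distrib diff_divide_distrib
        sum_divide_distrib mult.commute)
  then show ?thesis
    by (simp add: dual_objective_def smooth_part_def c G sum_negf n_def[symmetric])
qed

lemma dual_objective_MInfty:
  fixes A :: "real ^ 'n::finite ^ 'd::finite" and \<phi> :: "'n \<Rightarrow> real \<Rightarrow> real"
  assumes g: "strongly_convex 1 g" and i: "separable_part \<phi> \<gamma> i (x $ i) = \<infinity>"
  shows "dual_objective \<phi> g A lam x = - \<infinity>"
proof -
  obtain G where G: "\<And>u. conjugate g u = ereal (G u)"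
    using conjugate_strongly_convex[OF g] by (metis zero_less_one)
  have "conjugate (\<phi> i) (- (x $ i)) = \<infinity>"
    by (rule separable_part_cases[of \<phi> i "x $ i" \<gamma>]) (use i in auto)
  \<comment> \<open>In \<open>ereal\<close> the sum of \<infinity> and -\<infinity> is \<infinity>,
    so the value \<infinity> has to be excluded for the remaining terms.\<close>
  moreover have "(\<Sum>j\<in>UNIV - {i}. - conjugate (\<phi> j) (- (x $ j))) \<noteq> \<infinity>"
    unfolding sum_Pinfty using conjugate_neq_MInfty by (auto simp: ereal_uminus_eq_reorder)
  ultimately have "(\<Sum>j\<in>UNIV. - conjugate (\<phi> j) (- (x $ j))) = - \<infinity>"
    by (subst sum.remove[of _ i]) auto
  then show ?thesis by (simp add: dual_objective_def G)
qed

text \<open>Competitors agreeing with s off coordinate i suffice. The one that keeps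
  \<open>z $ i\<close> shows that z cannot deviate from s elsewhere; the others give the scalar
  minimality. The point \<open>u0\<close> keeps the minimal value finite.\<close>

lemma coordinate_argmin:
  fixes L :: "'n::finite \<Rightarrow> real" and z s y :: "real ^ 'n" and \<Psi> :: "real \<Rightarrow> ereal"
  assumes argmin: "is_arg_min (\<lambda>v. ereal (c / 2 * (weighted_norm L (v - s))\<^sup>2
      + d * (v $ i - y $ i)) + \<Psi> (v $ i)) (\<lambda>_. True) z"
    and c: "c > 0" and L: "\<And>j. L j > 0"
    and \<Psi>: "\<And>u. \<Psi> u \<noteq> - \<infinity>" and proper: "\<Psi> u0 \<noteq> \<infinity>"
  shows "\<Psi> (z $ i) \<noteq> \<infinity>" and "\<And>j. j \<noteq> i \<Longrightarrow> z $ j = s $ j"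
    and "\<And>v. \<Psi> v \<noteq> \<infinity> \<Longrightarrow>
      real_of_ereal (\<Psi> (z $ i)) + d * z $ i + c * L i / 2 * (z $ i - s $ i)\<^sup>2
      \<le> real_of_ereal (\<Psi> v) + d * v + c * L i / 2 * (v - s $ i)\<^sup>2"
proof -
  define cand where "cand v = (\<chi> j. if j = i then v else s $ j)" for v
  have norm: "(weighted_norm L (v - s))\<^sup>2
      = L i * (v $ i - s $ i)\<^sup>2 + (\<Sum>j\<in>UNIV - {i}. L j * (v $ j - s $ j)\<^sup>2)" for v
  proof -
    have "(weighted_norm L (v - s))\<^sup>2 = (\<Sum>j\<in>UNIV. L j * (v $ j - s $ j)\<^sup>2)"
      unfolding weighted_norm_def
      by (subst real_sqrt_pow2) (auto intro!: sum_nonneg simp: L less_imp_le)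
    then show ?thesis by (simp add: sum.remove[of _ i])
  qed
  have norm_cand: "(weighted_norm L (cand v - s))\<^sup>2 = L i * (v - s $ i)\<^sup>2" for v
    unfolding norm by (auto simp: cand_def intro!: sum.neutral)
  define rest where "rest = (\<Sum>j\<in>UNIV - {i}. L j * (z $ j - s $ j)\<^sup>2)"
  have rest: "rest \<ge> 0" unfolding rest_def by (auto intro!: sum_nonneg simp: L less_imp_le)
  have min: "ereal (c / 2 * (L i * (z $ i - s $ i)\<^sup>2 + rest) + d * (z $ i - y $ i)) + \<Psi> (z $ i)
      \<le> ereal (c / 2 * (L i * (v - s $ i)\<^sup>2) + d * (v - y $ i)) + \<Psi> v" for v
  proof -
    have "ereal (c / 2 * (weighted_norm L (z - s))\<^sup>2 + d * (z $ i - y $ i)) + \<Psi> (z $ i)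
      \<le> ereal (c / 2 * (weighted_norm L (cand v - s))\<^sup>2 + d * (cand v $ i - y $ i)) + \<Psi> (cand v $ i)"
      using argmin unfolding is_arg_min_def by (meson not_le)
    then show ?thesis unfolding norm_cand norm[of z] rest_def by (simp add: cand_def)
  qed
  show fin: "\<Psi> (z $ i) \<noteq> \<infinity>"
  proof
    assume "\<Psi> (z $ i) = \<infinity>"
    then have "ereal (c / 2 * (L i * (u0 - s $ i)\<^sup>2) + d * (u0 - y $ i)) + \<Psi> u0 = \<infinity>"
      using min[of u0] by simp
    then show False using proper by simp
  qed
  have real_min: "c / 2 * (L i * (z $ i - s $ i)\<^sup>2 + rest) + d * z $ i + real_of_ereal (\<Psi> (z $ i))
      \<le> c / 2 * (L i * (v - s $ i)\<^sup>2) + d * v + real_of_ereal (\<Psi> v)" if v: "\<Psi> v \<noteq> \<infinity>" for v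
  proof -
    obtain p where p: "\<Psi> (z $ i) = ereal p" using fin \<Psi> by (cases "\<Psi> (z $ i)") auto
    obtain q where q: "\<Psi> v = ereal q" using v \<Psi> by (cases "\<Psi> v") auto
    show ?thesis using min[of v] unfolding p q by (simp add: right_diff_distrib)
  qed
  have "c / 2 * rest \<le> 0" using real_min[OF fin] by (simp add: algebra_simps)
  then have "rest = 0" using rest c by (simp add: mult_le_0_iff)
  then have "\<forall>j\<in>UNIV - {i}. L j * (z $ j - s $ j)\<^sup>2 = 0"
    unfolding rest_def by (subst (asm) sum_nonneg_eq_0_iff) (auto simp: L less_imp_le)
  then show "z $ j = s $ j" if "j \<noteq> i" for j
  proof -
    have "L j * (z $ j - s $ j)\<^sup>2 = 0"
      using \<open>\<forall>j\<in>UNIV - {i}. L j * (z $ j - s $ j)\<^sup>2 = 0\<close> that by blast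
    moreover have "L j \<noteq> 0" using L[of j] by simp
    ultimately show ?thesis by simp
  qed
  show "real_of_ereal (\<Psi> (z $ i)) + d * z $ i + c * L i / 2 * (z $ i - s $ i)\<^sup>2
      \<le> real_of_ereal (\<Psi> v) + d * v + c * L i / 2 * (v - s $ i)\<^sup>2" if "\<Psi> v \<noteq> \<infinity>" for v
    using real_min[OF that] \<open>rest = 0\<close> by (simp add: algebra_simps)
qed

lemma geometric_decay_le:
  fixes a C \<epsilon> K :: real
  assumes a: "0 < a" "a \<le> 1" and K: "1 \<le> a * K" and C: "0 \<le> C" and \<epsilon>: "0 < \<epsilon>"
    and k: "real k \<ge> K * ln (C / \<epsilon>)"
  shows "(1 - a) ^ k * C \<le> \<epsilon>"
proof (cases "C \<le> \<epsilon>")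
  case True
  have "(1 - a) ^ k * C \<le> 1 * C"
    using a C by (intro mult_right_mono power_le_one) auto
  then show ?thesis using True by simp
next
  case False
  then have "ln (C / \<epsilon>) > 0" using \<epsilon> by simp
  then have "ln (C / \<epsilon>) \<le> a * K * ln (C / \<epsilon>)" using K by simp
  also have "\<dots> \<le> a * real k" using k a by (simp add: mult.assoc)
  finally have ak: "ln (C / \<epsilon>) \<le> a * real k" .
  have "(1 - a) ^ k \<le> exp (- a) ^ k"
    using a exp_ge_add_one_self[of "- a"] by (intro power_mono) auto
  also have "\<dots> = exp (- (a * real k))" by (simp add: exp_of_nat_mult[symmetric] mult.commute)
  also have "\<dots> \<le> exp (- ln (C / \<epsilon>))" using ak by simp
  also have "\<dots> = \<epsilon> / C" using False \<epsilon> by (simp add: exp_minus)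
  finally show ?thesis using False \<epsilon> C by (simp add: pos_le_divide_eq)
qed

section \<open>Instantiation to the dual problem and the iteration count\<close>

theorem theorem2:
  fixes A :: "real ^ 'n::finite ^ 'd::finite"
    and \<phi> :: "'n \<Rightarrow> real \<Rightarrow> real"
    and g :: "real ^ 'd \<Rightarrow> real"
    and lam \<gamma> R C \<epsilon> :: real
    and Dstar :: ereal
    and x0 xstar :: "real ^ 'n"
    and M :: "'w measure"
    and I :: "nat \<Rightarrow> 'w \<Rightarrow> 'n"
    and x y z :: "nat \<Rightarrow> 'w \<Rightarrow> real ^ 'n"
    and k :: nat
  defines "D \<equiv> dual_objective \<phi> g A lam"
    and "f \<equiv> smooth_part g A lam \<gamma>"
    and "\<Psi> \<equiv> separable_part \<phi> \<gamma>"
    and "L \<equiv> coord_lipschitz A lam \<gamma>"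
    and "\<mu> \<equiv> lam * \<gamma> * real CARD('n) / (R\<^sup>2 + lam * \<gamma> * real CARD('n))"
  assumes "\<gamma> > 0" and "lam > 0"
    and "\<And>i. convex_on UNIV (\<phi> i)"
    and "\<And>i. lipschitz_smooth (1 / \<gamma>) (\<phi> i)"
    and "strongly_convex 1 g"
    and "\<And>i. norm (column i A) \<le> R"
    and "is_arg_max D (\<lambda>_. True) xstar" and "Dstar = D xstar"
    and "prob_space M" and "iid_uniform M I"
    and "x0 \<in> separable_dom \<Psi>"
    and "\<And>\<omega>. \<omega> \<in> space M \<Longrightarrow>
           apcg_sequence f \<Psi> L \<mu> x0 (\<lambda>j. I j \<omega>) (\<lambda>j. x j \<omega>) (\<lambda>j. y j \<omega>) (\<lambda>j. z j \<omega>)"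
    and "C = real_of_ereal (Dstar - D x0) + \<gamma> / (2 * real CARD('n)) * (norm (x0 - xstar))\<^sup>2"
    and "\<epsilon> > 0"
    and "real k \<ge> (real CARD('n) + sqrt (real CARD('n) * R\<^sup>2 / (lam * \<gamma>))) * ln (C / \<epsilon>)"
  shows "(\<integral>\<^sup>+ \<omega>. e2ennreal (Dstar - D (x k \<omega>)) \<partial>M) \<le> ennreal \<epsilon>"
proof -
  define n where "n = real CARD('n)"
  have n: "n \<ge> 1" by (simp add: n_def Suc_leI)
  note \<gamma> = \<open>\<gamma> > 0\<close> and lam = \<open>lam > 0\<close>
  interpret prob_space M by (rule assms)
  have mu: "0 < \<mu>" "\<mu> \<le> 1"
    using \<gamma> lam n unfolding \<mu>_def n_def[symmetric] by (auto simp: field_simps add_pos_nonneg add_nonneg_pos)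
  have L_pos: "L i > 0" for i
    unfolding L_def coord_lipschitz_def using \<gamma> lam by (intro add_nonneg_pos) auto
  \<comment> \<open>With R in place of the column norm the coordinate constant becomes
    \<open>T / (lam * n\<^sup>2)\<close>, and \<mu> is \<gamma>/n divided by this number.\<close>
  have mu_L: "\<mu> * L i \<le> \<gamma> / n" for i
  proof -
    have R: "(norm (column i A))\<^sup>2 \<le> R\<^sup>2"
      using assms(11)[of i] by (intro power_mono) auto
    define T where "T = R\<^sup>2 + lam * \<gamma> * n"
    have T: "T > 0" using \<gamma> lam n by (simp add: T_def add_nonneg_pos)
    have "L i \<le> R\<^sup>2 / (lam * n\<^sup>2) + \<gamma> / n"
      unfolding L_def coord_lipschitz_def n_def[symmetric] using R lam by (simp add: divide_right_mono)
    also have "\<dots> = T / (lam * n\<^sup>2)"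
      using lam n by (simp add: T_def power2_eq_square field_simps)
    finally have "\<mu> * L i \<le> (lam * \<gamma> * n / T) * (T / (lam * n\<^sup>2))"
      using mu unfolding \<mu>_def T_def n_def[symmetric] by (intro mult_left_mono) auto
    also have "\<dots> = \<gamma> / n" using T lam n by (simp add: power2_eq_square)
    finally show ?thesis .
  qed
  have mu_norm: "\<mu> / 2 * (weighted_norm L u)\<^sup>2 \<le> \<gamma> / (2 * n) * (norm u)\<^sup>2" for u
  proof -
    have "(weighted_norm L u)\<^sup>2 = (\<Sum>i\<in>UNIV. L i * (u $ i)\<^sup>2)"
      unfolding weighted_norm_def
      by (rule real_sqrt_pow2) (auto intro!: sum_nonneg simp: L_pos less_imp_le)
    then have "\<mu> / 2 * (weighted_norm L u)\<^sup>2 = (\<Sum>i\<in>UNIV. (\<mu> * L i) * ((u $ i)\<^sup>2 / 2))"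
      by (simp add: sum_distrib_left mult_ac)
    also have "\<dots> \<le> (\<Sum>i\<in>UNIV. \<gamma> / n * ((u $ i)\<^sup>2 / 2))"
      by (intro sum_mono mult_right_mono mu_L) auto
    also have "\<dots> = \<gamma> / (2 * n) * (norm u)\<^sup>2"
      by (simp add: power2_norm_vec sum_distrib_left mult_ac)
    finally show ?thesis .
  qed
  obtain grad where grad: "\<And>i v. partial_deriv i f v = grad v $ i"
    and f_lower: "\<And>v u. f v + grad v \<bullet> u + \<gamma> / (2 * n) * (norm u)\<^sup>2 \<le> f (v + u)"
    and f_upper: "\<And>v i t. f (v + t *\<^sub>R axis i 1) \<le> f v + t * grad v $ i + L i / 2 * t\<^sup>2"
    using smooth_part_gradient[OF assms(10) lam \<gamma>, of A] unfolding f_def L_def n_def by blast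
  define S where "S i = {u. \<Psi> i u \<noteq> \<infinity>}" for i
  define p where "p i u = real_of_ereal (\<Psi> i u)" for i u
  interpret coordinate_descent f grad S p L \<mu>
  proof
    show "convex_on (S i) (p i)" for i
      using separable_part_convex[OF assms(9) \<gamma>] unfolding S_def p_def \<Psi>_def .
    show "f v + grad v \<bullet> u + \<mu> / 2 * (weighted_norm L u)\<^sup>2 \<le> f (v + u)" for v u
      using f_lower[of v u] mu_norm[of u] by linarith
  qed (use L_pos mu f_upper in auto)
  have D_Dom: "D v = ereal (- (f v + Psi v))" if "v \<in> Dom" for v
    using dual_objective_eq[OF assms(10), of \<phi> \<gamma> v A lam] that
    unfolding D_def f_def Psi_def p_def Dom_def S_def \<Psi>_def by simp
  have x0: "x0 \<in> Dom"
    using assms(16) unfolding separable_dom_def Dom_def S_def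
    by (auto simp: sum_Pinfty less_top[symmetric] simp flip: infinity_ereal_def)
  have D_le: "D v \<le> D xstar" for v
    using assms(12) unfolding is_arg_max_def by (meson not_le)
  \<comment> \<open>\<open>D x0\<close> is finite, whereas outside \<open>Dom\<close> the maximal
    value would be -\<infinity>.\<close>
  have xstar: "xstar \<in> Dom"
  proof (rule ccontr)
    assume "xstar \<notin> Dom"
    then have "D xstar = - \<infinity>"
      using dual_objective_MInfty[OF assms(10)] unfolding D_def Dom_def S_def \<Psi>_def by blast
    then show False using D_le[of x0] D_Dom[OF x0] by simp
  qed
  have opt: "f xstar + Psi xstar \<le> f v + Psi v" if "v \<in> Dom" for v
    using D_le[of v] D_Dom[OF that] D_Dom[OF xstar] by simp
  have traj: "trajectory x0 (\<lambda>j. I j \<omega>) (\<lambda>j. x j \<omega>) (\<lambda>j. y j \<omega>) (\<lambda>j. z j \<omega>)"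
    if \<omega>: "\<omega> \<in> space M" for \<omega>
  proof -
    have al: "sqrt \<mu> / n = \<alpha>" "n * \<alpha> = sqrt \<mu>" "n * \<alpha>\<^sup>2 = sqrt \<mu> * \<alpha>"
      using n by (simp_all add: \<alpha>_def n_def power2_eq_square)
    have seq: "x 0 \<omega> = x0" "z 0 \<omega> = x0"
      "\<And>k. y k \<omega> = (1 / (1 + \<alpha>)) *\<^sub>R (x k \<omega> + \<alpha> *\<^sub>R z k \<omega>)"
      "\<And>k. is_arg_min (\<lambda>v. ereal (sqrt \<mu> / 2 *
            (weighted_norm L (v - (1 - \<alpha>) *\<^sub>R z k \<omega> - \<alpha> *\<^sub>R y k \<omega>))\<^sup>2
          + partial_deriv (I k \<omega>) f (y k \<omega>) * (v $ I k \<omega> - y k \<omega> $ I k \<omega>)) + \<Psi> (I k \<omega>) (v $ I k \<omega>))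
        (\<lambda>v. True) (z (Suc k) \<omega>)"
      "\<And>k. x (Suc k) \<omega> = y k \<omega> + sqrt \<mu> *\<^sub>R (z (Suc k) \<omega> - z k \<omega>)
          + (sqrt \<mu> * \<alpha>) *\<^sub>R (z k \<omega> - y k \<omega>)"
      using assms(17)[OF \<omega>] unfolding apcg_sequence_def Let_def n_def[symmetric] al by blast+
    have "prox_step (I k \<omega>) (y k \<omega>) ((1 - \<alpha>) *\<^sub>R z k \<omega> + \<alpha> *\<^sub>R y k \<omega>) (z (Suc k) \<omega>)" for k
    proof -
      define i where "i = I k \<omega>"
      define s where "s = (1 - \<alpha>) *\<^sub>R z k \<omega> + \<alpha> *\<^sub>R y k \<omega>"
      have argmin: "is_arg_min (\<lambda>v. ereal (sqrt \<mu> / 2 * (weighted_norm L (v - s))\<^sup>2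
          + grad (y k \<omega>) $ i * (v $ i - y k \<omega> $ i)) + \<Psi> i (v $ i)) (\<lambda>_. True) (z (Suc k) \<omega>)"
        using seq(4)[of k] unfolding s_def i_def grad by (simp only: diff_diff_eq)
      have fin: "\<Psi> i u \<noteq> - \<infinity>" for u
        unfolding \<Psi>_def by (rule separable_part_cases[of \<phi> i u \<gamma>]) auto
      have proper: "\<Psi> i (x0 $ i) \<noteq> \<infinity>" using x0 by (simp add: Dom_def S_def)
      \<comment> \<open>This yields scalar minimality only; \<open>convex_on_prox_growth\<close>
        adds the quadratic growth that \<open>prox_step\<close> demands.\<close>
      note min = coordinate_argmin[OF argmin sqrt_mu(1) L_pos fin proper]
      have zi: "z (Suc k) \<omega> $ i \<in> S i" using min(1) by (simp add: S_def)
      show ?thesis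
        unfolding prox_step_def i_def[symmetric] s_def[symmetric]
      proof (intro conjI allI impI ballI)
        fix v assume v: "v \<in> S i"
        show "p i (z (Suc k) \<omega> $ i) + grad (y k \<omega>) $ i * z (Suc k) \<omega> $ i
            + sqrt \<mu> * L i / 2 * (z (Suc k) \<omega> $ i - s $ i)\<^sup>2
            + sqrt \<mu> * L i / 2 * (v - z (Suc k) \<omega> $ i)\<^sup>2
          \<le> p i v + grad (y k \<omega>) $ i * v + sqrt \<mu> * L i / 2 * (v - s $ i)\<^sup>2"
          by (rule convex_on_prox_growth[OF p_convex zi v])
            (use min(3) in \<open>simp add: p_def S_def\<close>)
      qed (use min(2) zi in auto)
    qed
    then show ?thesis unfolding trajectory_def using seq by blast
  qed
  define V where "V k \<omega> = potential xstar (x k \<omega>) (z k \<omega>) (averaged b (Psi \<circ> (\<lambda>j. z j \<omega>)) k)"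
    for k \<omega>
  have xk: "x k \<omega> \<in> Dom"
    and dual_gap: "f (x k \<omega>) + Psi (x k \<omega>) - (f xstar + Psi xstar) \<le> V k \<omega>"
    if \<omega>: "\<omega> \<in> space M" for k \<omega>
  proof -
    define w where "w = averaged b (\<lambda>j. z j \<omega>) k"
    have inv: "z k \<omega> \<in> Dom" "w \<in> Dom" "Psi w \<le> averaged b (Psi \<circ> (\<lambda>j. z j \<omega>)) k"
        "x k \<omega> = (1 - sqrt \<mu>) *\<^sub>R w + sqrt \<mu> *\<^sub>R z k \<omega>"
      using trajectory_invariant[OF traj[OF \<omega>] x0, of k] by (simp_all add: w_def o_def)
    show "x k \<omega> \<in> Dom" unfolding inv(4) by (rule Dom_convex) (use inv sqrt_mu(1,2) in auto)
    have "Psi (x k \<omega>) \<le> (1 - sqrt \<mu>) * Psi w + sqrt \<mu> * Psi (z k \<omega>)"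
      unfolding inv(4) by (rule Psi_convex) (use inv sqrt_mu(1,2) in auto)
    moreover have "(1 - sqrt \<mu>) * Psi w \<le> (1 - sqrt \<mu>) * averaged b (Psi \<circ> (\<lambda>j. z j \<omega>)) k"
      using inv(3) sqrt_mu(2) by (intro mult_left_mono) auto
    moreover have "0 \<le> \<mu> / 2 * (weighted_norm L (z k \<omega> - xstar))\<^sup>2" using mu by simp
    ultimately show "f (x k \<omega>) + Psi (x k \<omega>) - (f xstar + Psi xstar) \<le> V k \<omega>"
      unfolding V_def potential_def by linarith
  qed
  have C: "C = f x0 + Psi x0 - (f xstar + Psi xstar) + \<gamma> / (2 * n) * (norm (x0 - xstar))\<^sup>2"
    unfolding assms(18) \<open>Dstar = D xstar\<close> D_Dom[OF x0] D_Dom[OF xstar] n_def by simp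
  have "0 \<le> C"
    unfolding C using opt[OF x0] \<gamma> n by simp
  have "(\<integral>\<^sup>+ \<omega>. e2ennreal (Dstar - D (x k \<omega>)) \<partial>M) \<le> (\<integral>\<^sup>+ \<omega>. ennreal (V k \<omega>) \<partial>M)"
  proof (rule nn_integral_mono)
    fix \<omega> assume \<omega>: "\<omega> \<in> space M"
    have "Dstar - D (x k \<omega>) = ereal (f (x k \<omega>) + Psi (x k \<omega>) - (f xstar + Psi xstar))"
      unfolding \<open>Dstar = D xstar\<close> D_Dom[OF xk[OF \<omega>]] D_Dom[OF xstar] by simp
    then show "e2ennreal (Dstar - D (x k \<omega>)) \<le> ennreal (V k \<omega>)"
      using dual_gap[OF \<omega>, of k] by (simp add: e2ennreal_ereal ennreal_leI)
  qed
  also have "\<dots> \<le> ennreal ((1 - \<alpha>) ^ k * C)"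
  proof (rule nn_integral_descent[OF assms(15)])
    show "0 \<le> 1 - \<alpha>" using \<alpha>_bounds by simp
    show "0 \<le> V k \<omega>" if "\<omega> \<in> space M" for k \<omega>
      using dual_gap[OF that, of k] opt[OF xk[OF that, of k]] by linarith
    have same: "x k \<omega> = x k \<omega>'" "z k \<omega> = z k \<omega>'"
        "averaged b (Psi \<circ> (\<lambda>j. z j \<omega>)) k = averaged b (Psi \<circ> (\<lambda>j. z j \<omega>')) k"
      if "\<omega> \<in> space M" "\<omega>' \<in> space M" "\<And>j. j < k \<Longrightarrow> I j \<omega> = I j \<omega>'" for k \<omega> \<omega>'
    proof -
      have eq: "x j \<omega> = x j \<omega>'" "z j \<omega> = z j \<omega>'" if "j \<le> k" for j
        using trajectory_unique[OF traj traj, of \<omega> \<omega>' j] that \<open>\<omega> \<in> space M\<close> \<open>\<omega>' \<in> space M\<close>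
          \<open>\<And>j. j < k \<Longrightarrow> I j \<omega> = I j \<omega>'\<close> by auto
      show "x k \<omega> = x k \<omega>'" "z k \<omega> = z k \<omega>'" using eq by auto
      show "averaged b (Psi \<circ> (\<lambda>j. z j \<omega>)) k = averaged b (Psi \<circ> (\<lambda>j. z j \<omega>')) k"
        by (rule averaged_cong) (simp add: eq)
    qed
    show "V k \<omega> = V k \<omega>'"
      if "\<omega> \<in> space M" "\<omega>' \<in> space M" "\<And>j. j < k \<Longrightarrow> I j \<omega> = I j \<omega>'" for k \<omega> \<omega>'
      unfolding V_def using same[of \<omega> \<omega>' k] that by simp
    \<comment> \<open>Initially both Psi terms equal \<open>Psi x0\<close> and merge, and
      \<open>mu_norm\<close> bounds the weighted distance by the Euclidean term of C.\<close>
    show "V 0 \<omega> \<le> C" if "\<omega> \<in> space M" for \<omega>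
    proof -
      have "x 0 \<omega> = x0" "z 0 \<omega> = x0" using traj[OF that] by (auto simp: trajectory_def)
      then have "V 0 \<omega> = f x0 + Psi x0 - (f xstar + Psi xstar)
          + \<mu> / 2 * (weighted_norm L (x0 - xstar))\<^sup>2"
        by (simp add: V_def potential_def algebra_simps)
      then show ?thesis using mu_norm[of "x0 - xstar"] unfolding C by linarith
    qed
    \<comment> \<open>The points \<open>W i\<close> share their past and select i next: they realize
      all n outcomes of one iteration from the same state, as \<open>potential_descent\<close>
      requires.\<close>
    fix k i0 and W :: "'n \<Rightarrow> 'w"
    assume W: "\<And>i. W i \<in> space M" "\<And>i i' j. j < k \<Longrightarrow> I j (W i) = I j (W i')" "\<And>i. I k (W i) = i"
    define X0 Z0 Y0 q where "X0 = x k (W i0)" and "Z0 = z k (W i0)" and "Y0 = y k (W i0)"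
      and "q = averaged b (Psi \<circ> (\<lambda>j. z j (W i0))) k"
    have eq: "x k (W i) = X0" "z k (W i) = Z0" "averaged b (Psi \<circ> (\<lambda>j. z j (W i))) k = q" for i
      using same[OF W(1)[of i] W(1)[of i0] W(2)] by (simp_all add: X0_def Z0_def q_def)
    have step: "y k (W i) = (1 / (1 + \<alpha>)) *\<^sub>R (X0 + \<alpha> *\<^sub>R Z0)"
        "prox_step i (y k (W i)) ((1 - \<alpha>) *\<^sub>R Z0 + \<alpha> *\<^sub>R y k (W i)) (z (Suc k) (W i))"
        "x (Suc k) (W i) = y k (W i) + sqrt \<mu> *\<^sub>R (z (Suc k) (W i) - Z0)
          + (sqrt \<mu> * \<alpha>) *\<^sub>R (Z0 - y k (W i))" for i
      using traj[OF W(1)[of i]] unfolding trajectory_def eq(1,2)[of i, symmetric]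
      by (blast, metis W(3), blast)
    have Y0: "Y0 = (1 / (1 + \<alpha>)) *\<^sub>R (X0 + \<alpha> *\<^sub>R Z0)" and y: "y k (W i) = Y0" for i
      by (simp_all only: Y0_def step(1))
    define w where "w = averaged b (\<lambda>j. z j (W i0)) k"
    have inv: "Z0 \<in> Dom" "w \<in> Dom" "Psi w \<le> q" "X0 = sqrt \<mu> *\<^sub>R Z0 + (1 - sqrt \<mu>) *\<^sub>R w"
      using trajectory_invariant[OF traj[OF W(1)] x0, of k i0]
      by (simp_all add: w_def q_def X0_def Z0_def o_def)
    have "(\<Sum>i\<in>UNIV. V (Suc k) (W i)) = (\<Sum>i\<in>UNIV. potential xstar (x (Suc k) (W i))
        (z (Suc k) (W i)) ((1 - b) * q + b * Psi Z0))"
      using eq by (simp add: V_def)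
    also have "\<dots> \<le> real CARD('n) * (1 - \<alpha>) * potential xstar X0 Z0 q"
      by (rule potential_descent[OF xstar inv Y0 step(2)[unfolded y] step(3)[unfolded y]])
    finally show "(\<Sum>i\<in>UNIV. V (Suc k) (W i)) \<le> real CARD('n) * (1 - \<alpha>) * V k (W i0)"
      by (simp add: V_def q_def X0_def Z0_def)
  qed
  also have "\<dots> \<le> ennreal \<epsilon>"
  proof (rule ennreal_leI, rule geometric_decay_le[OF \<alpha>_bounds _ \<open>0 \<le> C\<close> \<open>\<epsilon> > 0\<close>])
    show "(n + sqrt (n * R\<^sup>2 / (lam * \<gamma>))) * ln (C / \<epsilon>) \<le> real k"
      using assms(20) by (simp add: n_def)
    \<comment> \<open>Taking roots and using subadditivity of \<open>sqrt\<close> bounds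
      \<open>1 / \<alpha>\<close> by the factor in front of the logarithm.\<close>
    have "n\<^sup>2 = \<mu> * (n\<^sup>2 + n * R\<^sup>2 / (lam * \<gamma>))"
    proof -
      have "R\<^sup>2 + lam * \<gamma> * n > 0" using \<gamma> lam n by (simp add: add_nonneg_pos)
      then have "\<mu> * (R\<^sup>2 + lam * \<gamma> * n) = lam * \<gamma> * n" by (simp add: \<mu>_def n_def)
      moreover have "n\<^sup>2 + n * R\<^sup>2 / (lam * \<gamma>) = (R\<^sup>2 + lam * \<gamma> * n) * (n / (lam * \<gamma>))"
        using \<gamma> lam by (simp add: power2_eq_square field_simps)
      ultimately have "\<mu> * (n\<^sup>2 + n * R\<^sup>2 / (lam * \<gamma>)) = lam * \<gamma> * n * (n / (lam * \<gamma>))"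
        by (metis mult.assoc)
      then show ?thesis using \<gamma> lam by (simp add: power2_eq_square)
    qed
    from arg_cong[OF this, of sqrt] have "sqrt (n\<^sup>2) = sqrt \<mu> * sqrt (n\<^sup>2 + n * R\<^sup>2 / (lam * \<gamma>))"
      by (simp only: real_sqrt_mult)
    also have "\<dots> \<le> sqrt \<mu> * (sqrt (n\<^sup>2) + sqrt (n * R\<^sup>2 / (lam * \<gamma>)))"
      using mu \<gamma> lam n by (intro mult_left_mono sqrt_add_le_add_sqrt) auto
    finally have "n \<le> sqrt \<mu> * (n + sqrt (n * R\<^sup>2 / (lam * \<gamma>)))" using n by simp
    then show "1 \<le> \<alpha> * (n + sqrt (n * R\<^sup>2 / (lam * \<gamma>)))"
      using n by (simp add: \<alpha>_def n_def[symmetric] pos_le_divide_eq)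
  qed
  finally show ?thesis .
qed

end
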